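(* Let $\mathfrak O$ be a compact discrete valuation ring, let $d,e\ge 1$, let $\mathcal A$ be an admissible partial colouring of $[d]\times[e]$, and let $u\in \mathrm M_{d\times e}(\mathfrak O)$ be a matrix all of whose entries are units of $\mathfrak O$. Let $(m,n,M,M')$, with $M'\subset M$, be one of the following: (1) $m=d$, $n=e$, $M=\mathrm M_{d\times e}(\mathfrak O)$, $M'=\mathrm{Rel}_{d\times e}(\mathcal A,u,\mathfrak O)$; (2) $m=n=d+e$, $M=\mathrm{Alt}_{d+e}(\mathfrak O)$, $M'=\mathrm{ARel}_{d\times e}(\mathcal A,u,\mathfrak O)$; (3) $m=n=d+e$, $M=\mathrm{Sym}_{d+e}(\mathfrak O)$, $M'=\mathrm{SRel}_{d\times e}(\mathcal A,u,\mathfrak O)$. Let $1\le r_1<\dotsb<r_m\le\tilde m$ and $1\le c_1<\dotsb<c_n\le\tilde n$ be integers, and let $\mathrm M_{m\times n}(\mathfrak O)\to \mathrm M_{\tilde m\times\tilde n}(\mathfrak O)$, $a\mapsto\tilde a$, be the $\mathfrak O$-linear embedding which sends the elementary matrix $\mathsf e_{ij}$ to $\mathsf e_{r_ic_j}$ for all $i,j$; write $\widetilde M$ and $\widetilde{M'}$ for the images of $M$ and $M'$. Let $N\subset \mathrm M_{\tilde m\times\tilde n}(\mathfrak O)$ be an arbitrary submodule. Then $$\mathsf Z^{\mathsf{ask}}_{\widetilde M+N}(T)=\mathsf Z^{\mathsf{ask}}_{\widetilde{M'}+N}(T).$$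
   Context: All rings are commutative and unital. $\mathfrak O$ has maximal ideal $\mathfrak P$ and finite residue field. Write $[d]=\{1,\dots,d\}$. Ask zeta functions. For a module $A\subset \mathrm M_{d\times e}(S)$ of matrices over a finite ring $S$, let $\mathrm{ask}(A)=\frac1{|A|}\sum_{a\in A}|\mathrm{Ker}(a)|$, where $d\times e$ matrices act by right multiplication on row vectors, i.e. $\mathrm{Ker}(a)=\{x\in S^d: xa=0\}$. For a submodule $M\subset \mathrm M_{d\times e}(\mathfrak O)$, let $M_n$ be its image in $\mathrm M_{d\times e}(\mathfrak O/\mathfrak P^n)$ and $\mathsf Z^{\mathsf{ask}}_M(T)=\sum_{n=0}^\infty \mathrm{ask}(M_n)T^n\in\mathbf Q[[T]]$. Partial colourings. Let $\mathcal C$ be a set (of colours). A partial colouring of $[d]\times[e]$ is a family $\mathcal A=(A_c)_{c\in\mathcal C}$ of pairwise disjoint (possibly empty) subsets of $[d]\times[e]$. A cell $(i,j)\in [d]\times[e]$ is blank if it belongs to no $A_c$. A subgrid is a set $G=I\times J$ with $I\subset[d]$, $J\subset[e]$; it is colour-closed if $A_c\subset G$ for every $c\in\mathcal C$ with $A_c\cap G\ne\emptyset$. $\mathcal A$ is admissible if every non-empty colour-closed subgrid of $[d]\times[e]$ contains a blank cell. Modules of matrices. $\mathrm{Alt}_d(R)$ is the module of alternating (antisymmetric with zero diagonal) and $\mathrm{Sym}_d(R)$ that of symmetric $d\times d$ matrices over a ring $R$. For a $d\times e$ matrix $u=[u_{ij}]$ with entries units of $R$, define $\mathrm{Rel}_{d\times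 e}(\mathcal A,u,R)=\{[x_{ij}]\in \mathrm M_{d\times e}(R): \sum_{(i,j)\in A_c}u_{ij}x_{ij}=0 \text{ for all } c\in\mathcal C\}$, $\mathrm{ARel}_{d\times e}(\mathcal A,u,R)=\left\{\begin{bmatrix} a & x \\ -x^\top & b \end{bmatrix}: a\in\mathrm{Alt}_d(R), b\in\mathrm{Alt}_e(R), x\in\mathrm{Rel}_{d\times e}(\mathcal A,u,R)\right\}$, $\mathrm{SRel}_{d\times e}(\mathcal A,u,R)=\left\{\begin{bmatrix} a & x \\ {x^\top} & b \end{bmatrix}: a\in\mathrm{Sym}_d(R), b\in\mathrm{Sym}_e(R), x\in\mathrm{Rel}_{d\times e}(\mathcal A,u,R)\right\}$. *)

theory Defs
  imports
    "HOL-Analysis.Abstract_Topology"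
    "HOL-Algebra.Ideal_Product"
    "HOL-Algebra.QuotRing"
    "HOL-Algebra.Ring_Divisibility"
    "HOL-Computational_Algebra.Formal_Power_Series"
    "HOL-Library.Disjoint_Sets"
    "Jordan_Normal_Form.Matrix"
begin

text \<open>
  Rings are commutative rings with explicit carrier. The types \<open>'a mat\<close> and \<open>'a vec\<close> serve as
  containers for entries from such a carrier; their index sets start at \<open>0\<close>, so the set
  \<open>[d] = {1, ..., d}\<close> is rendered as \<open>{..<d}\<close> throughout.
\<close>

unbundle no fps_syntax


subsection \<open>Compact discrete valuation rings\<close>

abbreviation ideal_pow :: "('a, 'b) ring_scheme \<Rightarrow> 'a set \<Rightarrow> nat \<Rightarrow> 'a set" where
  "ideal_pow R P n \<equiv> P [^]\<^bsub>ideals_set R\<^esub> n"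

definition adic_topology :: "('a, 'b) ring_scheme \<Rightarrow> 'a set \<Rightarrow> 'a topology" where
  "adic_topology R P =
     topology (\<lambda>U. U \<subseteq> carrier R \<and> (\<forall>x\<in>U. \<exists>n. ideal_pow R P n +>\<^bsub>R\<^esub> x \<subseteq> U))"

locale discrete_valuation_ring = principal_domain R for R (structure) +
  fixes P
  assumes maximal_P: "maximalideal P R"
    and unique_maximal: "maximalideal Q R \<Longrightarrow> Q = P"
    and P_nonzero: "P \<noteq> {\<zero>}"

locale compact_dvr = discrete_valuation_ring +
  assumes compact: "compact_space (adic_topology R P)"

lemma (in cring) ideal_pow_ideal:
  assumes "ideal P R"
  shows "ideal (ideal_pow R P n) R"
proof -
  interpret I: comm_monoid "ideals_set R" by (rule ideals_set_is_comm_monoid)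
  have "P [^]\<^bsub>ideals_set R\<^esub> n \<in> carrier (ideals_set R)"
    by (rule I.nat_pow_closed) (simp add: ideals_set_def assms)
  then show ?thesis by (simp add: ideals_set_def)
qed

lemma (in cring) ideal_pow_antimono:
  assumes "ideal P R" "k \<le> n"
  shows "ideal_pow R P n \<subseteq> ideal_pow R P k"
  using assms(2)
proof (induction n rule: dec_induct)
  case (step n)
  have "ideal_pow R P (Suc n) = ideal_prod R (ideal_pow R P n) P"
    by (simp add: ideals_set_def)
  also have "\<dots> \<subseteq> ideal_pow R P n"
    using ideal_prod_inter[OF ideal_pow_ideal[OF assms(1)] assms(1)] by blast
  finally show ?case using step.IH by blast
qed simp

lemma (in cring) istopology_adic:
  assumes "ideal P R"
  shows "istopology (\<lambda>U. U \<subseteq> carrier R \<and> (\<forall>x\<in>U. \<exists>n. ideal_pow R P n +> x \<subseteq> U))"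
  unfolding istopology_def
proof (intro conjI allI impI ballI; (elim conjE)?)
  fix S T x
  assume S: "\<forall>x\<in>S. \<exists>n. ideal_pow R P n +> x \<subseteq> S"
    and T: "\<forall>x\<in>T. \<exists>n. ideal_pow R P n +> x \<subseteq> T" and x: "x \<in> S \<inter> T"
  from S T x obtain k l where
    "ideal_pow R P k +> x \<subseteq> S" "ideal_pow R P l +> x \<subseteq> T" by blast
  moreover have "ideal_pow R P (max k l) +> x \<subseteq> ideal_pow R P j +> x" if "j \<le> max k l" for j
    using ideal_pow_antimono[OF assms that] by (auto simp: a_r_coset_def r_coset_def)
  ultimately have "ideal_pow R P (max k l) +> x \<subseteq> S \<inter> T"
    by (meson le_inf_iff max.cobounded1 max.cobounded2 order_trans)
  then show "\<exists>n. ideal_pow R P n +> x \<subseteq> S \<inter> T" by blast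
next
  fix K x
  assume "\<forall>S\<in>K. S \<subseteq> carrier R \<and> (\<forall>x\<in>S. \<exists>n. ideal_pow R P n +> x \<subseteq> S)" "x \<in> \<Union>K"
  then show "\<exists>n. ideal_pow R P n +> x \<subseteq> \<Union>K" by (meson Union_iff Union_upper order_trans)
qed blast+


subsection \<open>Modules of matrices\<close>

definition mats :: "('a, 'b) ring_scheme \<Rightarrow> nat \<Rightarrow> nat \<Rightarrow> 'a mat set" where
  "mats R d e = {A \<in> carrier_mat d e. \<forall>i<d. \<forall>j<e. A $$ (i, j) \<in> carrier R}"

text \<open>The multiplicative fields of the record play no role in a module.\<close>

definition mat_module :: "('a, 'b) ring_scheme \<Rightarrow> nat \<Rightarrow> nat \<Rightarrow> ('a, 'a mat) module" where
  "mat_module R d e =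
     \<lparr>carrier = mats R d e,
      monoid.mult = undefined,
      one = undefined,
      zero = mat d e (\<lambda>ij. \<zero>\<^bsub>R\<^esub>),
      add = (\<lambda>A B. mat d e (\<lambda>ij. A $$ ij \<oplus>\<^bsub>R\<^esub> B $$ ij)),
      smult = (\<lambda>c A. mat d e (\<lambda>ij. c \<otimes>\<^bsub>R\<^esub> A $$ ij))\<rparr>"

lemma (in cring) module_mat_module: "module R (mat_module R d e)"
proof (intro moduleI abelian_groupI)
  fix A assume A: "A \<in> carrier (mat_module R d e)"
  show "\<exists>B\<in>carrier (mat_module R d e). B \<oplus>\<^bsub>mat_module R d e\<^esub> A = \<zero>\<^bsub>mat_module R d e\<^esub>"
    by (rule bexI[of _ "mat d e (\<lambda>ij. \<ominus> (A $$ ij))"])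
      (use A in \<open>auto simp: mat_module_def mats_def l_neg\<close>)
qed (auto simp: mat_module_def mats_def a_ac m_assoc l_distr r_distr is_cring intro!: eq_matI)

definition elem_mat :: "('a, 'b) ring_scheme \<Rightarrow> nat \<Rightarrow> nat \<Rightarrow> nat \<Rightarrow> nat \<Rightarrow> 'a mat" where
  "elem_mat R d e i j = mat d e (\<lambda>ij. if ij = (i, j) then \<one>\<^bsub>R\<^esub> else \<zero>\<^bsub>R\<^esub>)"

text \<open>The linear map on \<open>m \<times> n\<close> matrices which sends the elementary matrix at \<open>(i, j)\<close> to the
  \<open>m' \<times> n'\<close> elementary matrix at \<open>(r i, c j)\<close>.\<close>

definition mat_embed ::
  "('a, 'b) ring_scheme \<Rightarrow> nat \<Rightarrow> nat \<Rightarrow> nat \<Rightarrow> nat \<Rightarrow> (nat \<Rightarrow> nat) \<Rightarrow> (nat \<Rightarrow> nat) \<Rightarrow> 'a mat \<Rightarrow> 'a mat"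
where
  "mat_embed R m n m' n' r c A =
     (\<Oplus>\<^bsub>mat_module R m' n'\<^esub>p\<in>{..<m} \<times> {..<n}.
        A $$ p \<odot>\<^bsub>mat_module R m' n'\<^esub> elem_mat R m' n' (r (fst p)) (c (snd p)))"

definition Alt :: "('a, 'b) ring_scheme \<Rightarrow> nat \<Rightarrow> 'a mat set" where
  "Alt R d = {A \<in> mats R d d.
     (\<forall>i<d. \<forall>j<d. A $$ (j, i) = \<ominus>\<^bsub>R\<^esub> (A $$ (i, j))) \<and> (\<forall>i<d. A $$ (i, i) = \<zero>\<^bsub>R\<^esub>)}"

definition Sym :: "('a, 'b) ring_scheme \<Rightarrow> nat \<Rightarrow> 'a mat set" where
  "Sym R d = {A \<in> mats R d d. transpose_mat A = A}"


subsection \<open>Ask zeta functions\<close>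

definition row_mult :: "('a, 'b) ring_scheme \<Rightarrow> 'a vec \<Rightarrow> 'a mat \<Rightarrow> 'a vec" where
  "row_mult S x A = vec (dim_col A) (\<lambda>j. \<Oplus>\<^bsub>S\<^esub>i\<in>{..<dim_row A}. x $ i \<otimes>\<^bsub>S\<^esub> A $$ (i, j))"

definition Ker :: "('a, 'b) ring_scheme \<Rightarrow> 'a mat \<Rightarrow> 'a vec set" where
  "Ker S A = {x \<in> carrier_vec (dim_row A). (\<forall>i<dim_row A. x $ i \<in> carrier S) \<and>
     row_mult S x A = vec (dim_col A) (\<lambda>j. \<zero>\<^bsub>S\<^esub>)}"

definition ask :: "('a, 'b) ring_scheme \<Rightarrow> 'a mat set \<Rightarrow> rat" where
  "ask S M = 1 / of_nat (card M) * (\<Sum>A\<in>M. of_nat (card (Ker S A)))"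

definition reduce_mats :: "('a, 'b) ring_scheme \<Rightarrow> 'a set \<Rightarrow> 'a mat set \<Rightarrow> 'a set mat set" where
  "reduce_mats R I M = map_mat (\<lambda>x. I +>\<^bsub>R\<^esub> x) ` M"

definition Zask :: "('a, 'b) ring_scheme \<Rightarrow> 'a set \<Rightarrow> 'a mat set \<Rightarrow> rat fps" where
  "Zask R P M =
     Abs_fps (\<lambda>n. ask (R Quot (ideal_pow R P n)) (reduce_mats R (ideal_pow R P n) M))"


subsection \<open>Partial colourings and relation modules\<close>

definition partial_colouring :: "nat \<Rightarrow> nat \<Rightarrow> 'c set \<Rightarrow> ('c \<Rightarrow> (nat \<times> nat) set) \<Rightarrow> bool" where
  "partial_colouring d e C \<A> \<longleftrightarrow>
     (\<forall>c\<in>C. \<A> c \<subseteq> {..<d} \<times> {..<e}) \<and> disjoint_family_on \<A> C"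

definition blank :: "'c set \<Rightarrow> ('c \<Rightarrow> (nat \<times> nat) set) \<Rightarrow> nat \<times> nat \<Rightarrow> bool" where
  "blank C \<A> p \<longleftrightarrow> (\<forall>c\<in>C. p \<notin> \<A> c)"

definition colour_closed :: "'c set \<Rightarrow> ('c \<Rightarrow> (nat \<times> nat) set) \<Rightarrow> (nat \<times> nat) set \<Rightarrow> bool" where
  "colour_closed C \<A> G \<longleftrightarrow> (\<forall>c\<in>C. \<A> c \<inter> G \<noteq> {} \<longrightarrow> \<A> c \<subseteq> G)"

definition admissible :: "nat \<Rightarrow> nat \<Rightarrow> 'c set \<Rightarrow> ('c \<Rightarrow> (nat \<times> nat) set) \<Rightarrow> bool" where
  "admissible d e C \<A> \<longleftrightarrow>
     (\<forall>I J. I \<subseteq> {..<d} \<longrightarrow> J \<subseteq> {..<e} \<longrightarrow> I \<times> J \<noteq> {} \<longrightarrow> colour_closed C \<A> (I \<times> J) \<longrightarrow>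
        (\<exists>p\<in>I \<times> J. blank C \<A> p))"

definition Rel :: "('a, 'b) ring_scheme \<Rightarrow> nat \<Rightarrow> nat \<Rightarrow> 'c set \<Rightarrow> ('c \<Rightarrow> (nat \<times> nat) set) \<Rightarrow>
    'a mat \<Rightarrow> 'a mat set" where
  "Rel R d e C \<A> u = {x \<in> mats R d e.
     \<forall>c\<in>C. (\<Oplus>\<^bsub>R\<^esub>p\<in>\<A> c. u $$ p \<otimes>\<^bsub>R\<^esub> x $$ p) = \<zero>\<^bsub>R\<^esub>}"

definition ARel :: "('a, 'b) ring_scheme \<Rightarrow> nat \<Rightarrow> nat \<Rightarrow> 'c set \<Rightarrow> ('c \<Rightarrow> (nat \<times> nat) set) \<Rightarrow>
    'a mat \<Rightarrow> 'a mat set" where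
  "ARel R d e C \<A> u =
     {four_block_mat a x (map_mat (a_inv R) (transpose_mat x)) b | a b x.
        a \<in> Alt R d \<and> b \<in> Alt R e \<and> x \<in> Rel R d e C \<A> u}"

definition SRel :: "('a, 'b) ring_scheme \<Rightarrow> nat \<Rightarrow> nat \<Rightarrow> 'c set \<Rightarrow> ('c \<Rightarrow> (nat \<times> nat) set) \<Rightarrow>
    'a mat \<Rightarrow> 'a mat set" where
  "SRel R d e C \<A> u =
     {four_block_mat a x (transpose_mat x) b | a b x.
        a \<in> Sym R d \<and> b \<in> Sym R e \<and> x \<in> Rel R d e C \<A> u}"

end

theory Submission
  imports Defs
begin

text \<open>
  Counting the pairs \<open>(x, a)\<close> with \<open>x a = 0\<close> by \<open>x\<close> shows that \<open>ask\<close> of a module \<open>A\<close> of matrices over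
  a finite ring is the sum of \<open>1 / |x A|\<close> over all row vectors \<open>x\<close>. So it suffices that \<open>x M\<close> and \<open>x M'\<close>
  agree modulo \<open>P\<^sup>k\<close> for all \<open>x\<close> and \<open>k\<close>; this property is inherited by \<open>M~ + N\<close> and \<open>M'~ + N\<close>. By Nakayama's
  argument one may work modulo \<open>P x M\<close>. Dividing \<open>x\<close> by an entry of minimal valuation, one sees that the
  cells \<open>(i, j)\<close> for which \<open>x\<close> times the generator of \<open>M\<close> at \<open>(i, j)\<close> is not in \<open>x M' + P x M\<close> form a
  rectangle. Were it non-empty, then either it is colour-closed and contains a blank cell, or the
  relation of some colour links a cell inside to one outside; both are contradictory.
\<close>


subsection \<open>Divisibility in a compact discrete valuation ring\<close>

text \<open>That \<open>x M\<close> and \<open>x M'\<close> agree modulo \<open>P\<^sup>k\<close> is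
  used in this form: every \<open>z\<close> in \<open>M\<close> is an element of \<open>M'\<close>
  plus some \<open>D\<close> for which \<open>x D\<close> has all entries in
  \<open>P\<^sup>k\<close>. This keeps the work over \<open>R\<close> and makes one argument serve
  all three cases. In the alternating and symmetric cases \<open>M'\<close> constrains only the
  upper right block, so it is enough that every \<open>d\<close> by \<open>e\<close> matrix lies in
  \<open>Rel + defect\<close>, where \<open>defect\<close> collects the upper right blocks of such
  \<open>D\<close>; the plain case arises from \<open>x = (v, w)\<close> with
  \<open>w = \<zero>\<close>. The obstacle is that a change of the upper right block also changes
  its mirror image below the diagonal. A diagonal block can absorb this disturbance once a single
  entry of \<open>x\<close> divides all entries of both \<open>v\<close> and \<open>w\<close>. So
  the minimum is taken over all of \<open>(v, w)\<close>; when it is attained in \<open>w\<close>,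
  transposition exchanges the two halves.\<close>

context discrete_valuation_ring
begin

lemma ideal_P: "ideal P R"
  using maximal_P by (rule maximalideal.axioms(1))

text \<open>A nonzero nonunit has an irreducible divisor. In a principal domain this divisor
  generates a maximal ideal, which can only be \<open>P\<close>.\<close>

lemma nonunit_in_P:
  assumes "x \<in> carrier R" "x \<notin> Units R"
  shows "x \<in> P"
proof (cases "x = \<zero>")
  case True
  then show ?thesis using additive_subgroup.zero_closed[OF ideal.axioms(1)[OF ideal_P]] by simp
next
  case False
  then obtain b where b: "b \<in> carrier R" "ring_irreducible b" "b divides x"
    using exists_irreducible_divisor[of x] assms by blast
  then have "PIdl b = P"
    using irreducible_imp_maximalideal unique_maximal by blast
  moreover have "x \<in> PIdl b"
    using b assms by (auto simp: cgenideal_def factor_def m_comm)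
  ultimately show ?thesis by simp
qed

lemma one_notin_P: "\<one> \<notin> P"
  using ideal.one_imp_carrier[OF ideal_P] maximalideal.I_notcarr[OF maximal_P] by auto

text \<open>This total preorder takes the place of a valuation. With \<open>g\<close> a generator of
  the ideal \<open>(a, b)\<close>, cancelling \<open>g\<close> in the Bezout identity gives
  \<open>s \<otimes> a' \<oplus> t \<otimes> b' = \<one>\<close>. As \<open>P\<close> is proper, one
  of the cofactors \<open>a'\<close>, \<open>b'\<close> is a unit, and the corresponding element is
  then associated to \<open>g\<close>.\<close>

lemma divides_comparable:
  assumes "a \<in> carrier R" "b \<in> carrier R"
  shows "a divides b \<or> b divides a"
proof -
  obtain g where g: "g \<in> carrier R" "PIdl a <+> PIdl b = PIdl g"
    using exists_gen[OF add_ideals[OF cgenideal_ideal cgenideal_ideal]] assms by metis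
  have self: "a \<in> PIdl a" "b \<in> PIdl b" and zero: "\<zero> \<in> PIdl a" "\<zero> \<in> PIdl b"
    using assms cgenideal_self cgenideal_ideal additive_subgroup.zero_closed ideal.axioms(1) by metis+
  have "a \<in> PIdl g" "b \<in> PIdl g"
    using g(2) set_add_def'[of R "PIdl a" "PIdl b"] self zero assms
    by (force intro: l_zero[symmetric] r_zero[symmetric])+
  then obtain a' b' where ab: "a' \<in> carrier R" "b' \<in> carrier R" "a = a' \<otimes> g" "b = b' \<otimes> g"
    by (auto simp: cgenideal_def)
  have "g \<in> PIdl a <+> PIdl b" using g cgenideal_self by simp
  then obtain s t where st: "s \<in> carrier R" "t \<in> carrier R" "g = s \<otimes> a \<oplus> t \<otimes> b"
    by (auto simp: cgenideal_def set_add_def')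
  show ?thesis
  proof (cases "g = \<zero>")
    case True
    then show ?thesis using ab by simp
  next
    case False
    have "(s \<otimes> a' \<oplus> t \<otimes> b') \<otimes> g = \<one> \<otimes> g"
      using st ab g by (simp add: l_distr m_assoc)
    then have one: "s \<otimes> a' \<oplus> t \<otimes> b' = \<one>"
      using m_rcancel[of g "s \<otimes> a' \<oplus> t \<otimes> b'" \<one>] False st(1,2) ab(1,2) g(1) by simp
    have "a' \<in> Units R \<or> b' \<in> Units R"
    proof (rule ccontr)
      assume "\<not> ?thesis"
      then have "a' \<in> P" "b' \<in> P" using nonunit_in_P ab by auto
      then have "s \<otimes> a' \<oplus> t \<otimes> b' \<in> P"
        using st(1,2) ideal_P by (simp add: ideal.I_l_closed additive_subgroup.a_closed ideal.axioms(1))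
      then show False using one one_notin_P by simp
    qed
    then show ?thesis
    proof
      assume u: "a' \<in> Units R"
      then have "g = inv a' \<otimes> a" using ab(1) g(1) by (simp add: ab(3) m_assoc[symmetric])
      then have "b = a \<otimes> (inv a' \<otimes> b')"
        using ab(1,2) u assms by (simp add: ab(4) m_ac)
      then show ?thesis using u ab(1,2) by (metis Units_inv_closed dividesI m_closed)
    next
      assume u: "b' \<in> Units R"
      then have "g = inv b' \<otimes> b" using ab(2) g(1) by (simp add: ab(4) m_assoc[symmetric])
      then have "a = b \<otimes> (inv b' \<otimes> a')"
        using ab(1,2) u assms by (simp add: ab(3) m_ac)
      then show ?thesis using u ab(1,2) by (metis Units_inv_closed dividesI m_closed)
    qed
  qed
qed

text \<open>The index \<open>\<mu>\<close> is a position of minimal valuation, which later serves as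
  a pivot.\<close>

lemma finite_has_common_divisor:
  assumes "finite I" "I \<noteq> {}" "x ` I \<subseteq> carrier R"
  shows "\<exists>\<mu>\<in>I. \<forall>i\<in>I. x \<mu> divides x i"
  using assms
proof (induction I rule: finite_ne_induct)
  case (singleton i)
  then show ?case by simp
next
  case (insert i I)
  then obtain \<mu> where \<mu>: "\<mu> \<in> I" "\<forall>j\<in>I. x \<mu> divides x j" by auto
  then have "x \<mu> divides x i \<or> x i divides x \<mu>"
    using insert.prems by (intro divides_comparable) auto
  then show ?case
    using \<mu> insert.prems divides_trans[of "x i" "x \<mu>"] by (auto 4 3)
qed

end

text \<open>The cosets of \<open>P\<^sup>n\<close> are open and cover the space, and two of them
  that meet are equal, so a finite subcover already contains every coset. This is where compactness
  enters.\<close>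

lemma (in compact_dvr) finite_quotient: "finite (carrier (R Quot ideal_pow R P n))"
proof -
  let ?Q = "\<lambda>n. ideal_pow R P n"
  interpret Q: ideal "?Q n" R by (rule ideal_pow_ideal[OF ideal_P])
  have openin: "openin (adic_topology R P) U \<longleftrightarrow>
      U \<subseteq> carrier R \<and> (\<forall>x\<in>U. \<exists>n. ?Q n +> x \<subseteq> U)" for U
    unfolding adic_topology_def using topology_inverse'[OF istopology_adic[OF ideal_P]] by simp
  have self: "x \<in> ?Q n +> x" if "x \<in> carrier R" for x
    using that by (rule Q.a_rcos_self)
  have sub: "?Q n +> x \<subseteq> carrier R" if "x \<in> carrier R" for x n
    using that ideal.axioms(1)[OF ideal_pow_ideal[OF ideal_P, of n]]
    by (meson a_r_coset_subset_G additive_subgroup.a_subset)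
  have top: "topspace (adic_topology R P) = carrier R"
    unfolding topspace_def openin using sub by blast
  have op: "openin (adic_topology R P) (?Q n +> x)" if "x \<in> carrier R" for x
    unfolding openin using sub[OF that] Q.a_repr_independence'[OF _ that] by (metis order_refl)
  have "compactin (adic_topology R P) (carrier R)"
    using compact top by (simp add: compact_space_def)
  then obtain F where F: "finite F" "F \<subseteq> (\<lambda>x. ?Q n +> x) ` carrier R" "carrier R \<subseteq> \<Union>F"
  proof -
    let ?\<U> = "(\<lambda>x. ?Q n +> x) ` carrier R"
    have "Ball ?\<U> (openin (adic_topology R P))" "carrier R \<subseteq> \<Union>?\<U>"
      using op self by blast+
    then show ?thesis
      using \<open>compactin _ _\<close> that unfolding compactin_def by (elim conjE allE[of _ ?\<U>]) auto
  qed
  have "carrier (R Quot ?Q n) \<subseteq> F"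
  proof
    fix X assume "X \<in> carrier (R Quot ?Q n)"
    then obtain x where x: "x \<in> carrier R" "X = ?Q n +> x"
      by (auto simp: FactRing_def A_RCOSETS_def')
    from F(3) x(1) obtain Y where Y: "Y \<in> F" "x \<in> Y" by (meson UnionE subsetD)
    from F(2) Y(1) obtain y where y: "y \<in> carrier R" "Y = ?Q n +> y" by (meson imageE subsetD)
    then show "X \<in> F" using x Y y Q.a_repr_independence'[of x y] by simp
  qed
  then show ?thesis using F(1) finite_subset by blast
qed


subsection \<open>Modules of matrices\<close>

lemma mat_module_simps:
  "carrier (mat_module R d e) = mats R d e"
  "\<zero>\<^bsub>mat_module R d e\<^esub> = mat d e (\<lambda>ij. \<zero>\<^bsub>R\<^esub>)"
  "A \<oplus>\<^bsub>mat_module R d e\<^esub> B = mat d e (\<lambda>ij. A $$ ij \<oplus>\<^bsub>R\<^esub> B $$ ij)"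
  "c \<odot>\<^bsub>mat_module R d e\<^esub> A = mat d e (\<lambda>ij. c \<otimes>\<^bsub>R\<^esub> A $$ ij)"
  by (simp_all add: mat_module_def)

lemma mats_dim: "A \<in> mats R d e \<Longrightarrow> dim_row A = d \<and> dim_col A = e"
  by (auto simp: mats_def)

lemma mats_closed [intro]: "A \<in> mats R d e \<Longrightarrow> i < d \<Longrightarrow> j < e \<Longrightarrow> A $$ (i, j) \<in> carrier R"
  by (auto simp: mats_def)

lemma mat_in_mats: "(\<And>i j. i < d \<Longrightarrow> j < e \<Longrightarrow> f (i, j) \<in> carrier R) \<Longrightarrow> mat d e f \<in> mats R d e"
  by (auto simp: mats_def)

lemma mats_eqI:
  assumes "A \<in> mats R d e" "B \<in> mats R d e" "\<And>i j. i < d \<Longrightarrow> j < e \<Longrightarrow> A $$ (i, j) = B $$ (i, j)"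
  shows "A = B"
  using assms by (auto simp: mats_def intro!: eq_matI)

context cring
begin

lemma mat_module_uminus:
  assumes "A \<in> mats R d e"
  shows "\<ominus>\<^bsub>mat_module R d e\<^esub> A = mat d e (\<lambda>ij. \<ominus> (A $$ ij))"
proof -
  interpret M: module R "mat_module R d e" by (rule module_mat_module)
  show ?thesis
    by (rule M.minus_equality)
      (use assms in \<open>auto simp: mat_module_simps mats_def l_neg intro!: eq_matI\<close>)
qed

lemma mat_module_minus:
  assumes "A \<in> mats R d e" "B \<in> mats R d e"
  shows "A \<ominus>\<^bsub>mat_module R d e\<^esub> B = mat d e (\<lambda>ij. A $$ ij \<ominus> B $$ ij)"
  unfolding a_minus_def mat_module_uminus[OF assms(2)] mat_module_simps
  by (auto simp: a_minus_def intro!: eq_matI)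

text \<open>The one-step subgroup test, with the difference written entrywise so that its uses
  reduce to identities between entries. Counting involves only the additive structure, hence
  subgroups in place of submodules.\<close>

lemma mats_subgroupI:
  assumes "A \<subseteq> mats R d e" "A \<noteq> {}"
    and "\<And>a b. a \<in> A \<Longrightarrow> b \<in> A \<Longrightarrow> mat d e (\<lambda>ij. a $$ ij \<ominus> b $$ ij) \<in> A"
  shows "subgroup A (add_monoid (mat_module R d e))"
proof -
  interpret M: module R "mat_module R d e" by (rule module_mat_module)
  have A: "A \<subseteq> carrier (mat_module R d e)" using assms(1) by (simp add: mat_module_simps)
  have minus: "a \<ominus>\<^bsub>mat_module R d e\<^esub> b \<in> A" if "a \<in> A" "b \<in> A" for a b
    using assms(3)[OF that] mat_module_minus[OF subsetD[OF assms(1) that(1)] subsetD[OF assms(1) that(2)]]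
    by simp
  obtain a where a: "a \<in> A" using assms(2) by blast
  have zero: "\<zero>\<^bsub>mat_module R d e\<^esub> \<in> A"
    using minus[OF a a] M.r_neg[OF subsetD[OF A a]] by (simp add: a_minus_def)
  have inv: "\<ominus>\<^bsub>mat_module R d e\<^esub> b \<in> A" if "b \<in> A" for b
    using minus[OF zero that] subsetD[OF A that] by (simp add: a_minus_def)
  have "b \<oplus>\<^bsub>mat_module R d e\<^esub> b' \<in> A" if "b \<in> A" "b' \<in> A" for b b'
    using minus[OF that(1) inv[OF that(2)]] subsetD[OF A that(2)] by (simp add: a_minus_def M.minus_minus)
  then show ?thesis
    using A assms(2) inv by (intro M.add.subgroupI) (auto simp: a_inv_def)
qed

lemma mats_subgroupD:
  assumes "subgroup A (add_monoid (mat_module R d e))"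
  shows "A \<subseteq> mats R d e"
    and "\<And>a b. a \<in> A \<Longrightarrow> b \<in> A \<Longrightarrow> mat d e (\<lambda>ij. a $$ ij \<oplus> b $$ ij) \<in> A"
    and "\<And>a b. a \<in> A \<Longrightarrow> b \<in> A \<Longrightarrow> mat d e (\<lambda>ij. a $$ ij \<ominus> b $$ ij) \<in> A"
    and "A \<noteq> {}"
proof -
  interpret M: module R "mat_module R d e" by (rule module_mat_module)
  show A: "A \<subseteq> mats R d e"
    using subgroup.subset[OF assms] by (simp add: mat_module_simps)
  show plus: "mat d e (\<lambda>ij. a $$ ij \<oplus> b $$ ij) \<in> A" if "a \<in> A" "b \<in> A" for a b
    using subgroup.m_closed[OF assms that] by (simp add: mat_module_simps)
  show "mat d e (\<lambda>ij. a $$ ij \<ominus> b $$ ij) \<in> A" if "a \<in> A" "b \<in> A" for a b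
  proof -
    have "a \<ominus>\<^bsub>mat_module R d e\<^esub> b \<in> A"
      using subgroup.m_closed[OF assms that(1) subgroup.m_inv_closed[OF assms that(2)]]
      by (simp add: a_minus_def a_inv_def)
    then show ?thesis using mat_module_minus[OF subsetD[OF A that(1)] subsetD[OF A that(2)]] by simp
  qed
  show "A \<noteq> {}" using subgroup.one_closed[OF assms] by blast
qed

end


subsection \<open>Average sizes of kernels\<close>

definition vecs :: "('a, 'b) ring_scheme \<Rightarrow> nat \<Rightarrow> 'a vec set" where
  "vecs R d = {x \<in> carrier_vec d. \<forall>i<d. x $ i \<in> carrier R}"

context cring
begin

lemma finite_vecs:
  assumes "finite (carrier R)"
  shows "finite (vecs R d)"
proof (rule finite_subset)
  show "vecs R d \<subseteq> (\<lambda>f. vec d f) ` PiE {..<d} (\<lambda>_. carrier R)"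
  proof
    fix x assume "x \<in> vecs R d"
    then have "x = vec d (restrict (($) x) {..<d})" "restrict (($) x) {..<d} \<in> PiE {..<d} (\<lambda>_. carrier R)"
      by (auto simp: vecs_def)
    then show "x \<in> (\<lambda>f. vec d f) ` PiE {..<d} (\<lambda>_. carrier R)" by blast
  qed
  show "finite ((\<lambda>f. vec d f) ` PiE {..<d} (\<lambda>_. carrier R))"
    using assms by (intro finite_imageI finite_PiE) auto
qed

lemma finite_mats:
  assumes "finite (carrier R)"
  shows "finite (mats R d e)"
proof (rule finite_subset)
  let ?F = "PiE ({..<d} \<times> {..<e}) (\<lambda>_. carrier R)"
  show "mats R d e \<subseteq> (\<lambda>f. mat d e f) ` ?F"
  proof
    fix x assume "x \<in> mats R d e"
    then have "x = mat d e (restrict (($$) x) ({..<d} \<times> {..<e}))" "restrict (($$) x) ({..<d} \<times> {..<e}) \<in> ?F"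
      by (auto simp: mats_def intro!: eq_matI)
    then show "x \<in> (\<lambda>f. mat d e f) ` ?F" by blast
  qed
  show "finite ((\<lambda>f. mat d e f) ` ?F)"
    using assms by (intro finite_imageI finite_PiE) auto
qed

lemma row_mult_add:
  assumes "x \<in> vecs R d" "a \<in> mats R d e" "b \<in> mats R d e" "j < e"
  shows "row_mult R x (mat d e (\<lambda>ij. a $$ ij \<oplus> b $$ ij)) $ j = row_mult R x a $ j \<oplus> row_mult R x b $ j"
proof -
  have "(\<Oplus>i\<in>{..<d}. x $ i \<otimes> (a $$ (i, j) \<oplus> b $$ (i, j)))
      = (\<Oplus>i\<in>{..<d}. x $ i \<otimes> a $$ (i, j) \<oplus> x $ i \<otimes> b $$ (i, j))"
    using assms by (intro finsum_cong') (auto simp: vecs_def mats_def r_distr)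
  also have "\<dots> = (\<Oplus>i\<in>{..<d}. x $ i \<otimes> a $$ (i, j)) \<oplus> (\<Oplus>i\<in>{..<d}. x $ i \<otimes> b $$ (i, j))"
    using assms by (intro finsum_addf) (auto simp: vecs_def mats_def)
  also have "(\<Oplus>i\<in>{..<d}. x $ i \<otimes> (a $$ (i, j) \<oplus> b $$ (i, j)))
      = (\<Oplus>i\<in>{..<d}. x $ i \<otimes> mat d e (\<lambda>ij. a $$ ij \<oplus> b $$ ij) $$ (i, j))"
    using assms by (intro finsum_cong') (auto simp: vecs_def mats_def)
  finally show ?thesis
    using assms mats_dim[of a R d e] mats_dim[of b R d e] by (simp add: row_mult_def)
qed

lemma row_mult_closed:
  assumes "x \<in> vecs R d" "a \<in> mats R d e" "j < e"
  shows "row_mult R x a $ j \<in> carrier R"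
  using assms mats_dim[of a R d e] by (auto simp: row_mult_def vecs_def intro!: finsum_closed)

text \<open>The map sending \<open>a\<close> to \<open>x a\<close> is additive, so translation by
  \<open>b\<close> is a bijection from its kernel in \<open>A\<close> onto the fibre through
  \<open>b\<close>; all fibres have the same size.\<close>

lemma card_row_mult_image:
  assumes "subgroup A (add_monoid (mat_module R d e))" "finite A" "x \<in> vecs R d"
  shows "card A = card (row_mult R x ` A) * card {a \<in> A. row_mult R x a = vec e (\<lambda>j. \<zero>)}"
proof -
  note A = mats_subgroupD[OF assms(1)]
  let ?K = "{a \<in> A. row_mult R x a = vec e (\<lambda>j. \<zero>)}"
  have row_eq: "row_mult R x a = row_mult R x b \<longleftrightarrow> (\<forall>j<e. row_mult R x a $ j = row_mult R x b $ j)"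
    if "a \<in> A" "b \<in> A" for a b
    using that A(1) mats_dim[of a R d e] mats_dim[of b R d e] by (auto simp: row_mult_def vec_eq_iff)
  have row_zero: "row_mult R x a = vec e (\<lambda>j. \<zero>) \<longleftrightarrow> (\<forall>j<e. row_mult R x a $ j = \<zero>)"
    if "a \<in> A" for a
    using that A(1) mats_dim[of a R d e] by (auto simp: row_mult_def vec_eq_iff)
  have fibre: "card {a \<in> A. row_mult R x a = row_mult R x b} = card ?K" if b: "b \<in> A" for b
  proof (rule bij_betw_same_card[symmetric], rule bij_betwI)
    let ?p = "\<lambda>a. mat d e (\<lambda>ij. a $$ ij \<oplus> b $$ ij)" and ?m = "\<lambda>a. mat d e (\<lambda>ij. a $$ ij \<ominus> b $$ ij)"
    have inv: "?p (?m a) = a" "?m (?p a) = a" if "a \<in> A" for a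
    proof -
      have ab: "a \<in> mats R d e" "b \<in> mats R d e" using that b A(1) by auto
      show "?p (?m a) = a"
        by (rule eq_matI) (use ab in \<open>auto simp: mats_def a_minus_def a_assoc l_neg\<close>)
      show "?m (?p a) = a"
        by (rule eq_matI) (use ab in \<open>auto simp: mats_def a_minus_def a_assoc r_neg\<close>)
    qed
    show "?p \<in> ?K \<rightarrow> {a \<in> A. row_mult R x a = row_mult R x b}"
    proof
      fix a assume a: "a \<in> ?K"
      then have "?p a \<in> A" using A(2)[of a b] b by blast
      then show "?p a \<in> {a \<in> A. row_mult R x a = row_mult R x b}"
      proof -
        have ab: "a \<in> A" "a \<in> mats R d e" "b \<in> mats R d e" using a b A(1) by auto
        have "row_mult R x (?p a) $ j = row_mult R x b $ j" if j: "j < e" for j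
          using row_mult_add[OF assms(3) ab(2,3) j] row_mult_closed[OF assms(3) ab(3) j] row_zero[OF ab(1)] a j
          by simp
        then show ?thesis using row_eq[OF \<open>?p a \<in> A\<close> b] \<open>?p a \<in> A\<close> by simp
      qed
    qed
    show "?m \<in> {a \<in> A. row_mult R x a = row_mult R x b} \<rightarrow> ?K"
    proof
      fix a assume a: "a \<in> {a \<in> A. row_mult R x a = row_mult R x b}"
      then have m: "?m a \<in> A" using A(3)[of a b] b by blast
      have ab: "?m a \<in> mats R d e" "b \<in> mats R d e" using m b A(1) by auto
      have "row_mult R x (?m a) $ j = \<zero>" if j: "j < e" for j
      proof -
        \<comment> \<open>Additivity has been shown for sums; the row of \<open>a - b\<close> is
          found by cancelling in \<open>(a - b) + b = a\<close>.\<close>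
        have "row_mult R x (?m a) $ j \<oplus> row_mult R x b $ j = row_mult R x (?p (?m a)) $ j"
          using row_mult_add[OF assms(3) ab j] by (rule sym)
        also have "\<dots> = row_mult R x b $ j" using a inv(1) by simp
        finally show ?thesis
          using row_mult_closed[OF assms(3) ab(1) j] row_mult_closed[OF assms(3) ab(2) j]
          using add.r_cancel_one by auto
      qed
      then show "?m a \<in> ?K" using m row_zero by blast
    qed
    show "?m (?p a) = a" if "a \<in> ?K" for a using inv that by blast
    show "?p (?m a) = a" if "a \<in> {a \<in> A. row_mult R x a = row_mult R x b}" for a using inv that by blast
  qed
  have "card A = (\<Sum>y\<in>row_mult R x ` A. card {a \<in> A. row_mult R x a = y})"
    using sum.image_gen[OF assms(2), of "\<lambda>_. 1::nat" "row_mult R x"] by simp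
  also have "\<dots> = (\<Sum>y\<in>row_mult R x ` A. card ?K)"
    using fibre by (intro sum.cong) auto
  finally show ?thesis by simp
qed

text \<open>Counting the pairs \<open>(x, a)\<close> with \<open>x a = 0\<close> in the other order.\<close>

lemma ask_eq_sum_inverse_card:
  assumes "finite (carrier R)" "subgroup A (add_monoid (mat_module R d e))"
  shows "ask R A = (\<Sum>x\<in>vecs R d. 1 / of_nat (card (row_mult R x ` A)))"
proof -
  note A = mats_subgroupD[OF assms(2)]
  have fin: "finite A" using A(1) finite_mats[OF assms(1)] finite_subset by blast
  have Ker: "Ker R a = {x \<in> vecs R d. row_mult R x a = vec e (\<lambda>j. \<zero>)}" if "a \<in> A" for a
    using that A(1) mats_dim[of a R d e] by (auto simp: Ker_def vecs_def)
  have pos: "card A > 0" using fin A(4) by (simp add: card_gt_0_iff)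
  have "(\<Sum>a\<in>A. card (Ker R a)) = (\<Sum>a\<in>A. \<Sum>x\<in>vecs R d. if row_mult R x a = vec e (\<lambda>j. \<zero>) then 1 else 0)"
    using Ker finite_vecs[OF assms(1)] by (intro sum.cong) (auto simp: sum.If_cases Int_def)
  also have "\<dots> = (\<Sum>x\<in>vecs R d. card {a \<in> A. row_mult R x a = vec e (\<lambda>j. \<zero>)})"
    using fin by (subst sum.swap) (auto simp: sum.If_cases Int_def intro!: sum.cong)
  finally have swap: "(\<Sum>a\<in>A. card (Ker R a))
      = (\<Sum>x\<in>vecs R d. card {a \<in> A. row_mult R x a = vec e (\<lambda>j. \<zero>)})" .
  have "(\<Sum>a\<in>A. of_nat (card (Ker R a))) = (of_nat (\<Sum>a\<in>A. card (Ker R a)) :: rat)"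
    by simp
  also have "\<dots> = (\<Sum>x\<in>vecs R d. of_nat (card {a \<in> A. row_mult R x a = vec e (\<lambda>j. \<zero>)}))"
    unfolding swap by simp
  finally have "(\<Sum>a\<in>A. of_nat (card (Ker R a)) :: rat)
      = (\<Sum>x\<in>vecs R d. of_nat (card {a \<in> A. row_mult R x a = vec e (\<lambda>j. \<zero>)}))" .
  \<comment> \<open>The share of \<open>A\<close> that \<open>x\<close> annihilates is the
    reciprocal of the size of the image \<open>x A\<close>.\<close>
  moreover have "of_nat (card {a \<in> A. row_mult R x a = vec e (\<lambda>j. \<zero>)}) / of_nat (card A)
      = (1 / of_nat (card (row_mult R x ` A)) :: rat)" if "x \<in> vecs R d" for x
  proof -
    have "of_nat (card A) = (of_nat (card (row_mult R x ` A))
        * of_nat (card {a \<in> A. row_mult R x a = vec e (\<lambda>j. \<zero>)}) :: rat)"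
      using card_row_mult_image[OF assms(2) fin that] by (metis of_nat_mult)
    moreover have "(of_nat (card A) :: rat) \<noteq> 0" using pos by simp
    ultimately show ?thesis by auto
  qed
  ultimately show ?thesis
    by (simp add: ask_def sum_divide_distrib)
qed

end

section \<open>Reduction modulo an ideal\<close>

lemma (in ring) coset_eq_iff:
  assumes "ideal I R" "a \<in> carrier R" "b \<in> carrier R"
  shows "I +> a = I +> b \<longleftrightarrow> a \<ominus> b \<in> I"
  using quotient_eq_iff_same_a_r_cos[OF assms] by simp

lemma carrier_Quot: "carrier (R Quot I) = (\<lambda>x. I +>\<^bsub>R\<^esub> x) ` carrier R"
  by (auto simp: FactRing_def A_RCOSETS_def')

context cring
begin

lemma reduce_mats_subgroup:
  assumes "ideal Q R" "subgroup B (add_monoid (mat_module R d e))"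
  shows "subgroup (reduce_mats R Q B) (add_monoid (mat_module (R Quot Q) d e))"
proof -
  interpret Q: ideal Q R by fact
  interpret h: ring_hom_cring R "R Quot Q" "(+>) Q" by (rule Q.rcos_ring_hom_cring[OF is_cring])
  note B = mats_subgroupD[OF assms(2)]
  show ?thesis
  proof (rule h.S.mats_subgroupI)
    show "reduce_mats R Q B \<subseteq> mats (R Quot Q) d e"
      using B(1) by (auto simp: reduce_mats_def mats_def subset_iff)
    show "reduce_mats R Q B \<noteq> {}" using B(4) by (simp add: reduce_mats_def)
    fix a b assume "a \<in> reduce_mats R Q B" "b \<in> reduce_mats R Q B"
    then obtain a' b' where ab: "a' \<in> B" "a = map_mat ((+>) Q) a'" "b' \<in> B" "b = map_mat ((+>) Q) b'"
      by (auto simp: reduce_mats_def)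
    then have ab': "a' \<in> mats R d e" "b' \<in> mats R d e" using B(1) by auto
    have "mat d e (\<lambda>ij. a $$ ij \<ominus>\<^bsub>R Quot Q\<^esub> b $$ ij)
        = map_mat ((+>) Q) (mat d e (\<lambda>ij. a' $$ ij \<ominus> b' $$ ij))"
      by (rule eq_matI) (use ab' in \<open>auto simp: ab mats_def a_minus_def\<close>)
    then show "mat d e (\<lambda>ij. a $$ ij \<ominus>\<^bsub>R Quot Q\<^esub> b $$ ij) \<in> reduce_mats R Q B"
      using B(3)[OF ab(1,3)] by (simp add: reduce_mats_def)
  qed
qed

text \<open>By \<open>ask_eq_sum_inverse_card\<close> the average depends on the module only through
  the sizes of its images under row vectors. The condition \<open>approx\<close> makes these images
  equal modulo \<open>Q\<close>; it speaks of lifted vectors over \<open>R\<close>, so its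
  verification never meets the quotient ring.\<close>

lemma ask_reduce_cong:
  assumes "ideal Q R" "finite (carrier (R Quot Q))"
    and B: "subgroup B (add_monoid (mat_module R d e))"
    and B': "subgroup B' (add_monoid (mat_module R d e))" "B' \<subseteq> B"
    and approx: "\<And>x b. (\<And>i. i < d \<Longrightarrow> x i \<in> carrier R) \<Longrightarrow> b \<in> B \<Longrightarrow>
      \<exists>b'\<in>B'. \<forall>j<e. (\<Oplus>i\<in>{..<d}. x i \<otimes> b $$ (i, j)) \<ominus> (\<Oplus>i\<in>{..<d}. x i \<otimes> b' $$ (i, j)) \<in> Q"
  shows "ask (R Quot Q) (reduce_mats R Q B) = ask (R Quot Q) (reduce_mats R Q B')"
proof -
  interpret Q: ideal Q R by fact
  interpret h: ring_hom_cring R "R Quot Q" "(+>) Q" by (rule Q.rcos_ring_hom_cring[OF is_cring])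
  let ?S = "R Quot Q"
  have "row_mult ?S x ` reduce_mats R Q B = row_mult ?S x ` reduce_mats R Q B'"
    if x: "x \<in> vecs ?S d" for x
  proof -
    have "\<forall>i<d. x $ i \<in> (+>) Q ` carrier R"
      using x unfolding vecs_def carrier_Quot by blast
    then have "\<forall>i<d. \<exists>y\<in>carrier R. x $ i = Q +> y" by (meson imageE)
    \<comment> \<open>A lift of the row vector \<open>x\<close> from the quotient to
      \<open>R\<close>.\<close>
    then obtain y where y: "\<And>i. i < d \<Longrightarrow> y i \<in> carrier R" "\<And>i. i < d \<Longrightarrow> x $ i = Q +> y i"
      by metis
    have row: "row_mult ?S x (map_mat ((+>) Q) b) = vec e (\<lambda>j. Q +> (\<Oplus>i\<in>{..<d}. y i \<otimes> b $$ (i, j)))"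
      if b: "b \<in> mats R d e" for b
    proof (rule eq_vecI)
      show "dim_vec (row_mult ?S x (map_mat ((+>) Q) b)) = dim_vec (vec e (\<lambda>j. Q +> (\<Oplus>i\<in>{..<d}. y i \<otimes> b $$ (i, j))))"
        using mats_dim[OF b] by (simp add: row_mult_def)
      fix j assume "j < dim_vec (vec e (\<lambda>j. Q +> (\<Oplus>i\<in>{..<d}. y i \<otimes> b $$ (i, j))))"
      then have j: "j < e" by simp
      have "(\<Oplus>\<^bsub>?S\<^esub>i\<in>{..<d}. x $ i \<otimes>\<^bsub>?S\<^esub> map_mat ((+>) Q) b $$ (i, j))
          = (\<Oplus>\<^bsub>?S\<^esub>i\<in>{..<d}. Q +> (y i \<otimes> b $$ (i, j)))"
        using y b j by (intro h.S.finsum_cong') (auto simp: mats_def)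
      also have "\<dots> = Q +> (\<Oplus>i\<in>{..<d}. y i \<otimes> b $$ (i, j))"
        using y b j by (subst h.hom_finsum) (auto simp: mats_def o_def)
      finally show "row_mult ?S x (map_mat ((+>) Q) b) $ j = vec e (\<lambda>j. Q +> (\<Oplus>i\<in>{..<d}. y i \<otimes> b $$ (i, j))) $ j"
        using mats_dim[OF b] j by (simp add: row_mult_def)
    qed
    have "\<exists>b'\<in>B'. row_mult ?S x (map_mat ((+>) Q) b) = row_mult ?S x (map_mat ((+>) Q) b')"
      if b: "b \<in> B" for b
    proof -
      obtain b' where b': "b' \<in> B'" "\<And>j. j < e \<Longrightarrow>
          (\<Oplus>i\<in>{..<d}. y i \<otimes> b $$ (i, j)) \<ominus> (\<Oplus>i\<in>{..<d}. y i \<otimes> b' $$ (i, j)) \<in> Q"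
        using approx[of y, OF _ b] y(1) by blast
      have mats: "b \<in> mats R d e" "b' \<in> mats R d e"
        using b b'(1) mats_subgroupD(1)[OF B] mats_subgroupD(1)[OF B'(1)] by auto
      have "Q +> (\<Oplus>i\<in>{..<d}. y i \<otimes> b $$ (i, j)) = Q +> (\<Oplus>i\<in>{..<d}. y i \<otimes> b' $$ (i, j))"
        if "j < e" for j
        using b'(2)[OF that] mats that y(1)
        by (subst coset_eq_iff[OF assms(1)]) (auto simp: mats_def intro!: finsum_closed)
      then show ?thesis
        using b'(1) row[OF mats(1)] row[OF mats(2)] by (intro bexI[of _ b']) (auto intro!: eq_vecI)
    qed
    \<comment> \<open>The reverse inclusion of the images comes from
      \<open>B' \<subseteq> B\<close>.\<close>
    then show ?thesis
      using B'(2) unfolding reduce_mats_def image_image by blast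
  qed
  then show ?thesis
    unfolding h.S.ask_eq_sum_inverse_card[OF assms(2) reduce_mats_subgroup[OF assms(1) B]]
      h.S.ask_eq_sum_inverse_card[OF assms(2) reduce_mats_subgroup[OF assms(1) B'(1)]]
    by (intro sum.cong) auto
qed

section \<open>Sums of modules and the embedding of matrices\<close>

lemma set_add_subgroup:
  assumes "subgroup A (add_monoid (mat_module R d e))" "subgroup B (add_monoid (mat_module R d e))"
  shows "subgroup (A <+>\<^bsub>mat_module R d e\<^esub> B) (add_monoid (mat_module R d e))"
proof (rule mats_subgroupI)
  note A = mats_subgroupD[OF assms(1)] and B = mats_subgroupD[OF assms(2)]
  have mem: "A <+>\<^bsub>mat_module R d e\<^esub> B = {mat d e (\<lambda>ij. a $$ ij \<oplus> b $$ ij) | a b. a \<in> A \<and> b \<in> B}"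
    by (auto simp: set_add_def' mat_module_simps)
  show "A <+>\<^bsub>mat_module R d e\<^esub> B \<subseteq> mats R d e"
    using A(1) B(1) by (auto simp: mem mats_def subset_iff)
  show "A <+>\<^bsub>mat_module R d e\<^esub> B \<noteq> {}" using A(4) B(4) by (auto simp: mem)
  fix x y assume "x \<in> A <+>\<^bsub>mat_module R d e\<^esub> B" "y \<in> A <+>\<^bsub>mat_module R d e\<^esub> B"
  then obtain a b a' b' where ab: "a \<in> A" "b \<in> B" "x = mat d e (\<lambda>ij. a $$ ij \<oplus> b $$ ij)"
    "a' \<in> A" "b' \<in> B" "y = mat d e (\<lambda>ij. a' $$ ij \<oplus> b' $$ ij)"
    unfolding mem by blast
  then have m: "a \<in> mats R d e" "b \<in> mats R d e" "a' \<in> mats R d e" "b' \<in> mats R d e"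
    using A(1) B(1) by auto
  have "mat d e (\<lambda>ij. x $$ ij \<ominus> y $$ ij)
      = mat d e (\<lambda>ij. mat d e (\<lambda>ij. a $$ ij \<ominus> a' $$ ij) $$ ij \<oplus> mat d e (\<lambda>ij. b $$ ij \<ominus> b' $$ ij) $$ ij)"
    by (rule eq_matI) (use m in \<open>auto simp: ab mats_def a_minus_def a_ac minus_add\<close>)
  then show "mat d e (\<lambda>ij. x $$ ij \<ominus> y $$ ij) \<in> A <+>\<^bsub>mat_module R d e\<^esub> B"
    using A(3)[OF ab(1,4)] B(3)[OF ab(2,5)] unfolding mem by blast
qed

lemma finsum_mat_index:
  assumes "finite I" "f \<in> I \<rightarrow> mats R d e" "i < d" "j < e"
  shows "(\<Oplus>\<^bsub>mat_module R d e\<^esub>p\<in>I. f p) $$ (i, j) = (\<Oplus>p\<in>I. f p $$ (i, j))"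
proof -
  interpret M: module R "mat_module R d e" by (rule module_mat_module)
  show ?thesis using assms(1,2)
  proof (induction I)
    case empty
    then show ?case using assms(3,4) by (simp add: mat_module_simps)
  next
    case (insert p I)
    have "(\<lambda>p. f p $$ (i, j)) \<in> I \<rightarrow> carrier R" "f p $$ (i, j) \<in> carrier R"
      using insert.prems assms(3,4) by (auto simp: mats_def)
    moreover have "(\<Oplus>\<^bsub>mat_module R d e\<^esub>p\<in>insert p I. f p)
        = f p \<oplus>\<^bsub>mat_module R d e\<^esub> (\<Oplus>\<^bsub>mat_module R d e\<^esub>p\<in>I. f p)"
      using insert by (intro M.finsum_insert) (auto simp: mat_module_simps)
    ultimately show ?case
      using insert assms(3,4) by (simp add: mat_module_simps)
  qed
qed

lemma elem_mat_in_mats: "elem_mat R d e i j \<in> mats R d e"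
  by (auto simp: elem_mat_def mats_def)

lemma mat_embed_in_mats:
  assumes "A \<in> mats R m n"
  shows "mat_embed R m n m' n' r c A \<in> mats R m' n'"
proof -
  interpret M: module R "mat_module R m' n'" by (rule module_mat_module)
  show ?thesis
    unfolding mat_embed_def using assms elem_mat_in_mats
    by (subst mat_module_simps(1)[symmetric], intro M.finsum_closed)
      (auto simp: mats_def mat_module_simps)
qed

lemma mat_embed_index:
  assumes "A \<in> mats R m n" "k < m'" "l < n'"
  shows "mat_embed R m n m' n' r c A $$ (k, l) =
    (\<Oplus>p\<in>{..<m} \<times> {..<n}. if k = r (fst p) \<and> l = c (snd p) then A $$ p else \<zero>)"
proof -
  let ?f = "\<lambda>p. A $$ p \<odot>\<^bsub>mat_module R m' n'\<^esub> elem_mat R m' n' (r (fst p)) (c (snd p))"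
  have f: "?f p = mat m' n' (\<lambda>ij. if ij = (r (fst p), c (snd p)) then A $$ p else \<zero>)"
    if "p \<in> {..<m} \<times> {..<n}" for p
    using assms(1) that by (intro eq_matI) (auto simp: mats_def mat_module_simps elem_mat_def)
  have "mat_embed R m n m' n' r c A $$ (k, l) = (\<Oplus>p\<in>{..<m} \<times> {..<n}. ?f p $$ (k, l))"
    unfolding mat_embed_def using assms f
    by (intro finsum_mat_index) (auto simp: mats_def)
  also have "\<dots> = (\<Oplus>p\<in>{..<m} \<times> {..<n}. if k = r (fst p) \<and> l = c (snd p) then A $$ p else \<zero>)"
    using assms by (intro finsum_cong') (auto simp: f mats_def)
  finally show ?thesis .
qed

lemma mat_embed_index_image:
  assumes "A \<in> mats R m n" "inj_on r {..<m}" "r ` {..<m} \<subseteq> {..<m'}" "inj_on c {..<n}" "c ` {..<n} \<subseteq> {..<n'}"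
    and "i < m" "j < n"
  shows "mat_embed R m n m' n' r c A $$ (r i, c j) = A $$ (i, j)"
proof -
  \<comment> \<open>Injectivity of \<open>r\<close> and \<open>c\<close> leaves the single summand
    \<open>p = (i, j)\<close>.\<close>
  have "mat_embed R m n m' n' r c A $$ (r i, c j)
      = (\<Oplus>p\<in>{..<m} \<times> {..<n}. if (i, j) = p then A $$ p else \<zero>)"
    using assms by (subst mat_embed_index) (auto simp: inj_on_def mats_def intro!: finsum_cong')
  also have "\<dots> = A $$ (i, j)"
    using assms by (intro add.finprod_singleton) (auto simp: mats_def)
  finally show ?thesis .
qed

lemma mat_embed_index_not_image:
  assumes "A \<in> mats R m n" "k < m'" "l < n'" "k \<notin> r ` {..<m} \<or> l \<notin> c ` {..<n}"
  shows "mat_embed R m n m' n' r c A $$ (k, l) = \<zero>"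
  unfolding mat_embed_index[OF assms(1-3)] using assms(4)
  by (intro add.finprod_one_eqI) (auto split: if_split)

lemma mat_embed_minus:
  assumes "inj_on r {..<m}" "r ` {..<m} \<subseteq> {..<m'}" "inj_on c {..<n}" "c ` {..<n} \<subseteq> {..<n'}"
    and "A \<in> mats R m n" "B \<in> mats R m n"
  shows "mat_embed R m n m' n' r c (mat m n (\<lambda>ij. A $$ ij \<ominus> B $$ ij))
    = mat m' n' (\<lambda>ij. mat_embed R m n m' n' r c A $$ ij \<ominus> mat_embed R m n m' n' r c B $$ ij)"
proof (rule mats_eqI)
  have AB: "mat m n (\<lambda>ij. A $$ ij \<ominus> B $$ ij) \<in> mats R m n"
    using assms(5,6) by (auto simp: mats_def)
  then show "mat_embed R m n m' n' r c (mat m n (\<lambda>ij. A $$ ij \<ominus> B $$ ij)) \<in> mats R m' n'"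
    by (rule mat_embed_in_mats)
  show "mat m' n' (\<lambda>ij. mat_embed R m n m' n' r c A $$ ij \<ominus> mat_embed R m n m' n' r c B $$ ij) \<in> mats R m' n'"
    using mat_embed_in_mats[OF assms(5), of m' n' r c] mat_embed_in_mats[OF assms(6), of m' n' r c]
    by (auto simp: mats_def)
  fix k l assume kl: "k < m'" "l < n'"
  show "mat_embed R m n m' n' r c (mat m n (\<lambda>ij. A $$ ij \<ominus> B $$ ij)) $$ (k, l)
    = mat m' n' (\<lambda>ij. mat_embed R m n m' n' r c A $$ ij \<ominus> mat_embed R m n m' n' r c B $$ ij) $$ (k, l)"
  proof (cases "k \<in> r ` {..<m} \<and> l \<in> c ` {..<n}")
    case True
    then obtain i j where "i < m" "j < n" "k = r i" "l = c j" by auto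
    then show ?thesis
      using kl by (simp add: mat_embed_index_image[OF AB assms(1-4)] mat_embed_index_image[OF assms(5,1-4)]
          mat_embed_index_image[OF assms(6,1-4)])
  next
    case False
    then show ?thesis
      using kl mat_embed_index_not_image[OF AB kl, of r c] mat_embed_index_not_image[OF assms(5) kl, of r c]
        mat_embed_index_not_image[OF assms(6) kl, of r c] by (auto simp: a_minus_def)
  qed
qed

lemma mat_embed_subgroup:
  assumes "inj_on r {..<m}" "r ` {..<m} \<subseteq> {..<m'}" "inj_on c {..<n}" "c ` {..<n} \<subseteq> {..<n'}"
    and "subgroup A (add_monoid (mat_module R m n))"
  shows "subgroup (mat_embed R m n m' n' r c ` A) (add_monoid (mat_module R m' n'))"
proof (rule mats_subgroupI)
  note A = mats_subgroupD[OF assms(5)]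
  show "mat_embed R m n m' n' r c ` A \<subseteq> mats R m' n'"
    using A(1) mat_embed_in_mats by blast
  show "mat_embed R m n m' n' r c ` A \<noteq> {}" using A(4) by simp
  fix x y assume "x \<in> mat_embed R m n m' n' r c ` A" "y \<in> mat_embed R m n m' n' r c ` A"
  then obtain a b where ab: "a \<in> A" "b \<in> A" "x = mat_embed R m n m' n' r c a" "y = mat_embed R m n m' n' r c b"
    by blast
  show "mat m' n' (\<lambda>ij. x $$ ij \<ominus> y $$ ij) \<in> mat_embed R m n m' n' r c ` A"
    unfolding ab(3,4) mat_embed_minus[OF assms(1-4) subsetD[OF A(1) ab(1)] subsetD[OF A(1) ab(2)], symmetric]
    using A(3)[OF ab(1,2)] by (rule imageI)
qed

text \<open>The rows of the embedded matrix outside the image of \<open>r\<close> vanish, so the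
  vector acts only through its entries at the selected rows. This reduces a product with an embedded
  matrix to a product with the original one.\<close>

lemma finsum_mat_embed:
  assumes "inj_on r {..<m}" "r ` {..<m} \<subseteq> {..<m'}" "inj_on c {..<n}" "c ` {..<n} \<subseteq> {..<n'}"
    and "A \<in> mats R m n" "j < n" "\<And>k. k < m' \<Longrightarrow> x k \<in> carrier R"
  shows "(\<Oplus>k\<in>{..<m'}. x k \<otimes> mat_embed R m n m' n' r c A $$ (k, c j)) = (\<Oplus>i\<in>{..<m}. x (r i) \<otimes> A $$ (i, j))"
proof -
  let ?f = "\<lambda>k. x k \<otimes> mat_embed R m n m' n' r c A $$ (k, c j)"
  have c: "c j < n'" using assms(4,6) by auto
  have closed: "?f k \<in> carrier R" if "k < m'" for k
    using mats_closed[OF mat_embed_in_mats[OF assms(5)] that c] assms(7)[OF that] by simp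
  have "(\<Oplus>k\<in>{..<m'}. ?f k) = (\<Oplus>k\<in>r ` {..<m}. ?f k)"
    using assms(2,7) c closed
    by (intro add.finprod_mono_neutral_cong_right) (auto simp: mat_embed_index_not_image[OF assms(5)])
  also have "\<dots> = (\<Oplus>i\<in>{..<m}. ?f (r i))"
    using assms(1,2) closed by (subst finsum_reindex) auto
  also have "\<dots> = (\<Oplus>i\<in>{..<m}. x (r i) \<otimes> A $$ (i, j))"
    using assms by (intro finsum_cong') (auto simp: mat_embed_index_image[OF assms(5,1-4)] mats_def)
  finally show ?thesis .
qed

lemma finsum_mult_minus:
  assumes "\<And>i. i \<in> I \<Longrightarrow> x i \<in> carrier R" "\<And>i. i \<in> I \<Longrightarrow> f i \<in> carrier R" "\<And>i. i \<in> I \<Longrightarrow> g i \<in> carrier R"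
  shows "(\<Oplus>i\<in>I. x i \<otimes> (f i \<ominus> g i)) = (\<Oplus>i\<in>I. x i \<otimes> f i) \<ominus> (\<Oplus>i\<in>I. x i \<otimes> g i)"
proof -
  have "(\<Oplus>i\<in>I. x i \<otimes> (f i \<ominus> g i)) \<oplus> (\<Oplus>i\<in>I. x i \<otimes> g i) = (\<Oplus>i\<in>I. x i \<otimes> (f i \<ominus> g i) \<oplus> x i \<otimes> g i)"
    using assms by (intro finsum_addf[symmetric]) auto
  also have "\<dots> = (\<Oplus>i\<in>I. x i \<otimes> f i)"
    using assms by (intro finsum_cong') (auto simp: a_minus_def r_distr[symmetric] a_assoc l_neg)
  finally have "(\<Oplus>i\<in>I. x i \<otimes> f i) = (\<Oplus>i\<in>I. x i \<otimes> (f i \<ominus> g i)) \<oplus> (\<Oplus>i\<in>I. x i \<otimes> g i)" ..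
  moreover have "(\<Oplus>i\<in>I. x i \<otimes> f i) \<in> carrier R" "(\<Oplus>i\<in>I. x i \<otimes> g i) \<in> carrier R"
    "(\<Oplus>i\<in>I. x i \<otimes> (f i \<ominus> g i)) \<in> carrier R"
    using assms by (auto intro!: finsum_closed)
  moreover have "b = a \<ominus> c" if "a = b \<oplus> c" "b \<in> carrier R" "c \<in> carrier R" for a b c
    using that by (simp add: a_minus_def a_assoc r_neg)
  ultimately show ?thesis by blast
qed


subsection \<open>Relation modules\<close>

lemma finsum_mult_add:
  assumes "\<And>i. i \<in> I \<Longrightarrow> x i \<in> carrier R" "\<And>i. i \<in> I \<Longrightarrow> f i \<in> carrier R" "\<And>i. i \<in> I \<Longrightarrow> g i \<in> carrier R"
  shows "(\<Oplus>i\<in>I. x i \<otimes> (f i \<oplus> g i)) = (\<Oplus>i\<in>I. x i \<otimes> f i) \<oplus> (\<Oplus>i\<in>I. x i \<otimes> g i)"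
proof -
  have "(\<Oplus>i\<in>I. x i \<otimes> (f i \<oplus> g i)) = (\<Oplus>i\<in>I. x i \<otimes> f i \<oplus> x i \<otimes> g i)"
    using assms by (intro finsum_cong') (auto simp: r_distr)
  also have "\<dots> = (\<Oplus>i\<in>I. x i \<otimes> f i) \<oplus> (\<Oplus>i\<in>I. x i \<otimes> g i)"
    using assms by (intro finsum_addf) auto
  finally show ?thesis .
qed

lemma finsum_mult_left:
  assumes "finite I" "s \<in> carrier R" "\<And>i. i \<in> I \<Longrightarrow> x i \<in> carrier R" "\<And>i. i \<in> I \<Longrightarrow> f i \<in> carrier R"
  shows "(\<Oplus>i\<in>I. x i \<otimes> (s \<otimes> f i)) = s \<otimes> (\<Oplus>i\<in>I. x i \<otimes> f i)"
proof -
  have "(\<Oplus>i\<in>I. x i \<otimes> (s \<otimes> f i)) = (\<Oplus>i\<in>I. s \<otimes> (x i \<otimes> f i))"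
    using assms by (intro finsum_cong') (auto simp: m_lcomm)
  also have "\<dots> = s \<otimes> (\<Oplus>i\<in>I. x i \<otimes> f i)"
    using assms by (intro finsum_rdistr[symmetric]) auto
  finally show ?thesis .
qed

text \<open>The condition \<open>b\<close> stands for the column test in an entry of an elementary
  matrix; it is constant while the sum runs over rows.\<close>

lemma finsum_delta:
  assumes "finite I" "\<mu> \<in> I" "\<And>i. i \<in> I \<Longrightarrow> x i \<in> carrier R" "s \<in> carrier R"
  shows "(\<Oplus>i\<in>I. x i \<otimes> (if i = \<mu> \<and> b then s else \<zero>)) = (if b then x \<mu> \<otimes> s else \<zero>)"
proof -
  have "(\<Oplus>i\<in>I. x i \<otimes> (if i = \<mu> \<and> b then s else \<zero>)) = (\<Oplus>i\<in>I. if \<mu> = i then (if b then x i \<otimes> s else \<zero>) else \<zero>)"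
    using assms by (intro finsum_cong') auto
  also have "\<dots> = (if b then x \<mu> \<otimes> s else \<zero>)"
    using assms by (intro add.finprod_singleton) auto
  finally show ?thesis .
qed

lemma finsum_zero_terms:
  assumes "\<And>i. i \<in> I \<Longrightarrow> f i = \<zero>"
  shows "(\<Oplus>i\<in>I. f i) = \<zero>"
  using assms by (rule add.finprod_one_eqI)

lemma mats_submoduleI:
  assumes "V \<subseteq> mats R d e" "V \<noteq> {}"
    and add: "\<And>x y. x \<in> V \<Longrightarrow> y \<in> V \<Longrightarrow> mat d e (\<lambda>ij. x $$ ij \<oplus> y $$ ij) \<in> V"
    and smult: "\<And>s x. s \<in> carrier R \<Longrightarrow> x \<in> V \<Longrightarrow> mat d e (\<lambda>ij. s \<otimes> x $$ ij) \<in> V"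
  shows "submodule V R (mat_module R d e)"
proof -
  have "subgroup V (add_monoid (mat_module R d e))"
  proof (rule mats_subgroupI[OF assms(1,2)])
    fix a b assume ab: "a \<in> V" "b \<in> V"
    then have m: "a \<in> mats R d e" "b \<in> mats R d e" using assms(1) by auto
    have "mat d e (\<lambda>ij. a $$ ij \<ominus> b $$ ij) = mat d e (\<lambda>ij. a $$ ij \<oplus> mat d e (\<lambda>ij. \<ominus> \<one> \<otimes> b $$ ij) $$ ij)"
      by (rule eq_matI) (use m in \<open>auto simp: mats_def a_minus_def l_minus\<close>)
    then show "mat d e (\<lambda>ij. a $$ ij \<ominus> b $$ ij) \<in> V"
      using add[OF ab(1) smult[OF _ ab(2), of "\<ominus> \<one>"]] by simp
  qed
  then show ?thesis
    using smult by (intro submodule.intro) (auto simp: submodule_axioms_def mat_module_simps)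
qed

lemma mats_submoduleD:
  assumes "submodule V R (mat_module R d e)"
  shows "V \<subseteq> mats R d e"
    and "\<And>x y. x \<in> V \<Longrightarrow> y \<in> V \<Longrightarrow> mat d e (\<lambda>ij. x $$ ij \<oplus> y $$ ij) \<in> V"
    and "\<And>s x. s \<in> carrier R \<Longrightarrow> x \<in> V \<Longrightarrow> mat d e (\<lambda>ij. s \<otimes> x $$ ij) \<in> V"
  using mats_subgroupD[OF submodule.axioms(1)[OF assms]] submodule.smult_closed[OF assms]
  by (simp_all add: mat_module_simps)

lemma Rel_in_mats: "Rel R d e C \<A> u \<subseteq> mats R d e"
  by (auto simp: Rel_def)

context
  fixes d e :: nat and C :: "'c set" and \<A> and u
  assumes col: "partial_colouring d e C \<A>" and u: "u \<in> mats R d e"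
begin

lemma colour_class_cell:
  assumes "c \<in> C" "p \<in> \<A> c"
  shows "fst p < d" "snd p < e" "u $$ p \<in> carrier R"
proof -
  have "p \<in> {..<d} \<times> {..<e}" using assms col unfolding partial_colouring_def by blast
  then show "fst p < d" "snd p < e" "u $$ p \<in> carrier R"
    using u by (auto simp: mats_def)
qed

lemma mats_cell_closed:
  assumes "c \<in> C" "p \<in> \<A> c" "x \<in> mats R d e"
  shows "x $$ p \<in> carrier R"
  using colour_class_cell[OF assms(1,2)] assms(3) by (cases p) (auto simp: mats_def)

lemma finite_colour_class: "c \<in> C \<Longrightarrow> finite (\<A> c)"
  using col unfolding partial_colouring_def by (meson finite_SigmaI finite_lessThan finite_subset)

lemma zero_in_Rel: "mat d e (\<lambda>_. \<zero>) \<in> Rel R d e C \<A> u"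
proof -
  have "(\<Oplus>p\<in>\<A> c. u $$ p \<otimes> mat d e (\<lambda>_. \<zero>) $$ p) = \<zero>" if c: "c \<in> C" for c
  proof (rule finsum_zero_terms)
    fix p assume "p \<in> \<A> c"
    then show "u $$ p \<otimes> mat d e (\<lambda>_. \<zero>) $$ p = \<zero>"
      using colour_class_cell[OF c, of p] by (cases p) auto
  qed
  then show ?thesis by (auto simp: Rel_def mats_def)
qed

lemma Rel_add:
  assumes "x \<in> Rel R d e C \<A> u" "y \<in> Rel R d e C \<A> u"
  shows "mat d e (\<lambda>ij. x $$ ij \<oplus> y $$ ij) \<in> Rel R d e C \<A> u"
proof -
  have xy: "x \<in> mats R d e" "y \<in> mats R d e" using assms by (auto simp: Rel_def)
  have "(\<Oplus>p\<in>\<A> c. u $$ p \<otimes> mat d e (\<lambda>ij. x $$ ij \<oplus> y $$ ij) $$ p) = \<zero>" if c: "c \<in> C" for c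
  proof -
    have "(\<Oplus>p\<in>\<A> c. u $$ p \<otimes> mat d e (\<lambda>ij. x $$ ij \<oplus> y $$ ij) $$ p)
        = (\<Oplus>p\<in>\<A> c. u $$ p \<otimes> (x $$ p \<oplus> y $$ p))"
      using colour_class_cell[OF c] mats_cell_closed[OF c _ xy(1)] mats_cell_closed[OF c _ xy(2)]
      by (intro finsum_cong') (auto simp: split_paired_all)
    also have "\<dots> = (\<Oplus>p\<in>\<A> c. u $$ p \<otimes> x $$ p) \<oplus> (\<Oplus>p\<in>\<A> c. u $$ p \<otimes> y $$ p)"
      using colour_class_cell[OF c] mats_cell_closed[OF c _ xy(1)] mats_cell_closed[OF c _ xy(2)]
      by (intro finsum_mult_add) auto
    also have "\<dots> = \<zero>" using assms c by (simp add: Rel_def)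
    finally show ?thesis .
  qed
  moreover have "mat d e (\<lambda>ij. x $$ ij \<oplus> y $$ ij) \<in> mats R d e" using xy by (auto simp: mats_def)
  ultimately show ?thesis by (simp add: Rel_def)
qed

lemma Rel_smult:
  assumes "x \<in> Rel R d e C \<A> u" "s \<in> carrier R"
  shows "mat d e (\<lambda>ij. s \<otimes> x $$ ij) \<in> Rel R d e C \<A> u"
proof -
  have x: "x \<in> mats R d e" using assms by (auto simp: Rel_def)
  have "(\<Oplus>p\<in>\<A> c. u $$ p \<otimes> mat d e (\<lambda>ij. s \<otimes> x $$ ij) $$ p) = \<zero>" if c: "c \<in> C" for c
  proof -
    have "(\<Oplus>p\<in>\<A> c. u $$ p \<otimes> mat d e (\<lambda>ij. s \<otimes> x $$ ij) $$ p)
        = (\<Oplus>p\<in>\<A> c. u $$ p \<otimes> (s \<otimes> x $$ p))"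
      using colour_class_cell[OF c] mats_cell_closed[OF c _ x] assms(2)
      by (intro finsum_cong') (auto simp: split_paired_all)
    also have "\<dots> = s \<otimes> (\<Oplus>p\<in>\<A> c. u $$ p \<otimes> x $$ p)"
      using colour_class_cell[OF c] mats_cell_closed[OF c _ x] assms(2) finite_colour_class[OF c]
      by (intro finsum_mult_left) auto
    also have "\<dots> = \<zero>" using assms c by (simp add: Rel_def)
    finally show ?thesis .
  qed
  moreover have "mat d e (\<lambda>ij. s \<otimes> x $$ ij) \<in> mats R d e" using x assms(2) by (auto simp: mats_def)
  ultimately show ?thesis by (simp add: Rel_def)
qed

lemma elem_mat_in_Rel:
  assumes "blank C \<A> p"
  shows "elem_mat R d e (fst p) (snd p) \<in> Rel R d e C \<A> u"
proof -
  have "(\<Oplus>q\<in>\<A> c. u $$ q \<otimes> elem_mat R d e (fst p) (snd p) $$ q) = \<zero>" if c: "c \<in> C" for c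
  proof (rule finsum_zero_terms)
    fix q assume q: "q \<in> \<A> c"
    then have "q \<noteq> p" using assms c by (auto simp: blank_def)
    then show "u $$ q \<otimes> elem_mat R d e (fst p) (snd p) $$ q = \<zero>"
      using colour_class_cell[OF c q] by (cases q, cases p) (auto simp: elem_mat_def)
  qed
  then show ?thesis by (simp add: Rel_def elem_mat_in_mats)
qed

text \<open>The coefficients are exchanged on purpose: the cells \<open>p\<close> and
  \<open>q\<close> contribute \<open>u $$ p \<otimes> u $$ q\<close> with opposite signs to the
  relation of \<open>c\<close>. By disjointness no other colour meets either cell.\<close>

lemma elem_mat_diff_in_Rel:
  assumes c: "c \<in> C" "p \<in> \<A> c" "q \<in> \<A> c" and "p \<noteq> q"
  shows "mat d e (\<lambda>ij. u $$ q \<otimes> elem_mat R d e (fst p) (snd p) $$ ij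
    \<oplus> \<ominus> (u $$ p) \<otimes> elem_mat R d e (fst q) (snd q) $$ ij) \<in> Rel R d e C \<A> u" (is "?D \<in> _")
proof -
  note pq = colour_class_cell[OF c(1,2)] colour_class_cell[OF c(1,3)]
  let ?s = "u $$ p \<otimes> u $$ q"
  have "(\<Oplus>x\<in>\<A> c'. u $$ x \<otimes> ?D $$ x) = \<zero>" if c': "c' \<in> C" for c'
  proof -
    have D: "u $$ x \<otimes> ?D $$ x = (if p = x then ?s else \<zero>) \<oplus> (if q = x then \<ominus> ?s else \<zero>)" if "x \<in> \<A> c'" for x
      using colour_class_cell[OF c' that] pq assms(4)
      by (cases x, cases p, cases q) (auto simp: elem_mat_def m_comm r_minus l_minus)
    show ?thesis
    proof (cases "c' = c")
      case True
      have "(\<Oplus>x\<in>\<A> c. u $$ x \<otimes> ?D $$ x)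
          = (\<Oplus>x\<in>\<A> c. (if p = x then ?s else \<zero>) \<oplus> (if q = x then \<ominus> ?s else \<zero>))"
        using pq by (intro finsum_cong' D[unfolded True]) auto
      also have "\<dots> = (\<Oplus>x\<in>\<A> c. if p = x then ?s else \<zero>) \<oplus> (\<Oplus>x\<in>\<A> c. if q = x then \<ominus> ?s else \<zero>)"
        using pq by (intro finsum_addf) auto
      also have "(\<Oplus>x\<in>\<A> c. if p = x then ?s else \<zero>) = ?s"
        using pq finite_colour_class[OF c(1)] c(2)
        by (intro add.finprod_singleton[where f = "\<lambda>_. ?s"]) auto
      also have "(\<Oplus>x\<in>\<A> c. if q = x then \<ominus> ?s else \<zero>) = \<ominus> ?s"
        using pq finite_colour_class[OF c(1)] c(3)
        by (intro add.finprod_singleton[where f = "\<lambda>_. \<ominus> ?s"]) auto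
      finally show ?thesis using True pq by (simp add: r_neg)
    next
      case False
      then have "\<A> c' \<inter> \<A> c = {}"
        using col c(1) c' unfolding partial_colouring_def disjoint_family_on_def by blast
      then have "p \<notin> \<A> c'" "q \<notin> \<A> c'" using c by blast+
      then show ?thesis
        by (intro finsum_zero_terms) (auto simp: D)
    qed
  qed
  moreover have "?D \<in> mats R d e"
    using pq elem_mat_in_mats[of d e "fst p" "snd p"] elem_mat_in_mats[of d e "fst q" "snd q"]
    by (auto simp: mats_def)
  ultimately show ?thesis by (simp add: Rel_def)
qed

section \<open>Submodules that contain the relation module\<close>

context
  fixes V
  assumes V: "submodule V R (mat_module R d e)" and Rel_V: "Rel R d e C \<A> u \<subseteq> V"
begin

lemmas V_mats = mats_submoduleD(1)[OF V]
  and V_add = mats_submoduleD(2)[OF V]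
  and V_smult = mats_submoduleD(3)[OF V]

lemma unit_smult_in_V:
  assumes "s \<in> Units R" "x \<in> mats R d e" "mat d e (\<lambda>ij. s \<otimes> x $$ ij) \<in> V"
  shows "x \<in> V"
proof -
  have "mat d e (\<lambda>ij. inv s \<otimes> mat d e (\<lambda>ij. s \<otimes> x $$ ij) $$ ij) = x"
    by (rule eq_matI) (use assms(1,2) in \<open>auto simp: mats_def m_assoc[symmetric] Units_closed\<close>)
  then show ?thesis using V_smult[OF Units_inv_closed[OF assms(1)] assms(3)] by simp
qed

lemma diff_in_V:
  assumes "mat d e (\<lambda>ij. x $$ ij \<oplus> s \<otimes> y $$ ij) \<in> V" "s \<in> carrier R" "x \<in> mats R d e" "y \<in> V"
  shows "x \<in> V"
proof -
  have y: "y \<in> mats R d e" using assms V_mats by blast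
  have "mat d e (\<lambda>ij. mat d e (\<lambda>ij. x $$ ij \<oplus> s \<otimes> y $$ ij) $$ ij \<oplus> mat d e (\<lambda>ij. \<ominus> s \<otimes> y $$ ij) $$ ij) = x"
    by (rule eq_matI) (use assms(2,3) y in \<open>auto simp: mats_def a_assoc l_minus r_neg\<close>)
  then show ?thesis using V_add[OF assms(1) V_smult[OF _ assms(4), of "\<ominus> s"]] assms(2) by simp
qed

text \<open>If \<open>I \<times> J\<close> is colour-closed, it has a blank cell, whose elementary matrix lies in \<open>Rel\<close>. Otherwise
  some colour class has a cell inside and a cell outside, and the relation between these two cells
  moves the inner one into \<open>V\<close>.\<close>

lemma elem_mats_in_V:
  assumes adm: "admissible d e C \<A>" and units: "\<forall>i<d. \<forall>j<e. u $$ (i, j) \<in> Units R"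
    and I: "I \<subseteq> {..<d}" and J: "J \<subseteq> {..<e}"
    and rect: "\<forall>i<d. \<forall>j<e. elem_mat R d e i j \<notin> V \<longleftrightarrow> i \<in> I \<and> j \<in> J"
    and ij: "i < d" "j < e"
  shows "elem_mat R d e i j \<in> V"
proof (rule ccontr)
  assume "elem_mat R d e i j \<notin> V"
  then have ne: "I \<times> J \<noteq> {}" using rect[rule_format, OF ij] by auto
  show False
  proof (cases "colour_closed C \<A> (I \<times> J)")
    case True
    then obtain i j where p: "i \<in> I" "j \<in> J" "blank C \<A> (i, j)"
      using adm I J ne unfolding admissible_def by blast
    then have "i < d" "j < e" using I J by auto
    then show False
      using elem_mat_in_Rel[OF p(3)] Rel_V rect[rule_format, of i j] p(1,2) by auto
  next
    case False
    then obtain c p q where c: "c \<in> C" "p \<in> \<A> c" "q \<in> \<A> c" "p \<in> I \<times> J" "q \<notin> I \<times> J"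
      unfolding colour_closed_def by blast
    note pq = colour_class_cell[OF c(1,2)] colour_class_cell[OF c(1,3)]
    let ?E = "\<lambda>p. elem_mat R d e (fst p) (snd p)"
    have E: "?E p \<in> mats R d e" "?E q \<in> mats R d e" by (simp_all add: elem_mat_in_mats)
    \<comment> \<open>The outer cell is already in \<open>V\<close> by the choice of the rectangle.
      Removing it from the relation leaves \<open>u $$ q\<close> times the inner elementary matrix,
      and this unit can be inverted.\<close>
    have q: "?E q \<in> V" using rect[rule_format, OF pq(4,5)] c(5) by (cases q) auto
    let ?x = "mat d e (\<lambda>ij. u $$ q \<otimes> ?E p $$ ij)"
    have "p \<noteq> q" using c by auto
    moreover have "mat d e (\<lambda>ij. ?x $$ ij \<oplus> \<ominus> (u $$ p) \<otimes> ?E q $$ ij)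
        = mat d e (\<lambda>ij. u $$ q \<otimes> ?E p $$ ij \<oplus> \<ominus> (u $$ p) \<otimes> ?E q $$ ij)"
      by (rule eq_matI) auto
    ultimately have "mat d e (\<lambda>ij. ?x $$ ij \<oplus> \<ominus> (u $$ p) \<otimes> ?E q $$ ij) \<in> V"
      using elem_mat_diff_in_Rel[OF c(1-3)] Rel_V by auto
    moreover have "?x \<in> mats R d e" using E pq by (auto simp: mats_def)
    ultimately have "?x \<in> V" using diff_in_V[of ?x "\<ominus> (u $$ p)" "?E q"] q pq by auto
    moreover have "u $$ q \<in> Units R" using units[rule_format, OF pq(4,5)] by simp
    ultimately have "?E p \<in> V" using unit_smult_in_V E by blast
    then show False using rect[rule_format, OF pq(1,2)] c(4) by (cases p) auto
  qed
qed

text \<open>The expansion of \<open>x\<close> in elementary matrices is \<open>mat_embed\<close> for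
  the identity maps on rows and columns, unfolded by its definition.\<close>

lemma mats_spanned_by_elem_mats:
  assumes E: "\<forall>i<d. \<forall>j<e. elem_mat R d e i j \<in> V" and x: "x \<in> mats R d e"
  shows "x \<in> V"
proof -
  interpret M: module R "mat_module R d e" by (rule module_mat_module)
  let ?f = "\<lambda>p. x $$ p \<odot>\<^bsub>mat_module R d e\<^esub> elem_mat R d e (id (fst p)) (id (snd p))"
  have f: "?f p \<in> V" if "p \<in> {..<d} \<times> {..<e}" for p
    using V_smult[of "x $$ p", OF _ E[rule_format, of "fst p" "snd p"]] x that
    by (cases p) (auto simp: mat_module_simps mats_def)
  have "(\<Oplus>\<^bsub>mat_module R d e\<^esub>p\<in>S. ?f p) \<in> V" if "S \<subseteq> {..<d} \<times> {..<e}" "finite S" for S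
    using that(2,1)
  proof (induction S)
    case empty
    then show ?case using Rel_V zero_in_Rel by (auto simp: mat_module_simps)
  next
    case (insert p S)
    have "(\<Oplus>\<^bsub>mat_module R d e\<^esub>p\<in>insert p S. ?f p) = ?f p \<oplus>\<^bsub>mat_module R d e\<^esub> (\<Oplus>\<^bsub>mat_module R d e\<^esub>p\<in>S. ?f p)"
    proof (rule M.finsum_insert[OF insert.hyps])
      show "?f \<in> S \<rightarrow> carrier (mat_module R d e)" "?f p \<in> carrier (mat_module R d e)"
        using f V_mats insert.prems unfolding mat_module_simps(1) by blast+
    qed
    moreover have "?f p \<in> V" using insert.prems by (intro f) auto
    ultimately show ?case
      using V_add[of "?f p" "\<Oplus>\<^bsub>mat_module R d e\<^esub>p\<in>S. ?f p"] insert by (simp add: mat_module_simps(3))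
  qed
  then have "mat_embed R d e d e id id x \<in> V"
    unfolding mat_embed_def by simp
  moreover have "mat_embed R d e d e id id x = x"
    using mat_embed_index_image[OF x, of id d id e]
    by (intro mats_eqI[OF mat_embed_in_mats[OF x] x]) auto
  ultimately show ?thesis by simp
qed

end

end

end

subsection \<open>Alternating and symmetric matrices\<close>

text \<open>A Boolean selects between the two kinds of matrices, so that the block argument is
  carried out once for both.\<close>

definition form_mats :: "('a, 'b) ring_scheme \<Rightarrow> bool \<Rightarrow> nat \<Rightarrow> 'a mat set" where
  "form_mats R alt n = (if alt then Alt R n else Sym R n)"

definition form_sign :: "('a, 'b) ring_scheme \<Rightarrow> bool \<Rightarrow> 'a" where
  "form_sign R alt = (if alt then \<ominus>\<^bsub>R\<^esub> \<one>\<^bsub>R\<^esub> else \<one>\<^bsub>R\<^esub>)"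

text \<open>With \<open>y = (v, w)\<close>, a matrix \<open>x\<close> belongs to \<open>defect\<close> if \<open>y\<close> maps some alternating (symmetric)
  matrix with upper right block \<open>x\<close> into \<open>Q\<close>; up to sign, its diagonal blocks are \<open>a\<close> and \<open>b\<close>.\<close>

definition defect :: "('a, 'b) ring_scheme \<Rightarrow> bool \<Rightarrow> nat \<Rightarrow> nat \<Rightarrow> (nat \<Rightarrow> 'a) \<Rightarrow> (nat \<Rightarrow> 'a) \<Rightarrow> 'a set \<Rightarrow> 'a mat set"
where
  "defect R alt d e v w Q = {x \<in> mats R d e. \<exists>a\<in>form_mats R alt d. \<exists>b\<in>form_mats R alt e.
     (\<forall>j<e. (\<Oplus>\<^bsub>R\<^esub>i\<in>{..<d}. v i \<otimes>\<^bsub>R\<^esub> x $$ (i, j)) \<oplus>\<^bsub>R\<^esub> (\<Oplus>\<^bsub>R\<^esub>k\<in>{..<e}. w k \<otimes>\<^bsub>R\<^esub> b $$ (k, j)) \<in> Q) \<and>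
     (\<forall>i<d. (\<Oplus>\<^bsub>R\<^esub>j\<in>{..<e}. w j \<otimes>\<^bsub>R\<^esub> x $$ (i, j)) \<oplus>\<^bsub>R\<^esub> (\<Oplus>\<^bsub>R\<^esub>k\<in>{..<d}. v k \<otimes>\<^bsub>R\<^esub> a $$ (k, i)) \<in> Q)}"

context cring
begin

lemma form_sign_closed [simp]: "form_sign R alt \<in> carrier R"
  by (simp add: form_sign_def)

lemma form_sign_square: "form_sign R alt \<otimes> form_sign R alt = \<one>"
  by (simp add: form_sign_def l_minus r_minus)

text \<open>A common description by the behaviour under transposition, which spares most later
  proofs a case split. The zero diagonal remains a separate clause: in characteristic 2 the sign
  rule does not imply it.\<close>

lemma mem_form_mats:
  "A \<in> form_mats R alt n \<longleftrightarrow> A \<in> mats R n n \<and>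
     (\<forall>i<n. \<forall>j<n. A $$ (j, i) = form_sign R alt \<otimes> A $$ (i, j)) \<and> (alt \<longrightarrow> (\<forall>i<n. A $$ (i, i) = \<zero>))"
proof (cases "A \<in> mats R n n")
  case A: True
  show ?thesis
  proof (cases alt)
    case True
    have "form_sign R alt \<otimes> A $$ (i, j) = \<ominus> (A $$ (i, j))" if "i < n" "j < n" for i j
      using True mats_closed[OF A that] by (simp add: form_sign_def l_minus)
    then have "(\<forall>i<n. \<forall>j<n. A $$ (j, i) = form_sign R alt \<otimes> A $$ (i, j))
        \<longleftrightarrow> (\<forall>i<n. \<forall>j<n. A $$ (j, i) = \<ominus> (A $$ (i, j)))" by simp
    then show ?thesis
      unfolding form_mats_def Alt_def using True A by simp
  next
    case False
    have "form_sign R alt \<otimes> A $$ (i, j) = A $$ (i, j)" if "i < n" "j < n" for i j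
      using False mats_closed[OF A that] by (simp add: form_sign_def)
    then have "(\<forall>i<n. \<forall>j<n. A $$ (j, i) = form_sign R alt \<otimes> A $$ (i, j))
        \<longleftrightarrow> (\<forall>i<n. \<forall>j<n. A $$ (j, i) = A $$ (i, j))" by simp
    moreover have "transpose_mat A = A \<longleftrightarrow> (\<forall>i<n. \<forall>j<n. A $$ (j, i) = A $$ (i, j))"
      using mats_dim[OF A] unfolding mat_eq_iff by auto
    ultimately show ?thesis
      unfolding form_mats_def Sym_def using False A by simp
  qed
qed (auto simp: form_mats_def Alt_def Sym_def)

lemma form_mats_in_mats: "form_mats R alt n \<subseteq> mats R n n"
  by (auto simp: mem_form_mats)

lemma form_matsD:
  "A \<in> form_mats R alt n \<Longrightarrow> i < n \<Longrightarrow> j < n \<Longrightarrow> A $$ (j, i) = form_sign R alt \<otimes> A $$ (i, j)"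
  "A \<in> form_mats R alt n \<Longrightarrow> alt \<Longrightarrow> i < n \<Longrightarrow> A $$ (i, i) = \<zero>"
  unfolding mem_form_mats by blast+

lemma form_matsI:
  assumes "A \<in> mats R n n" "\<And>i j. i < n \<Longrightarrow> j < n \<Longrightarrow> A $$ (j, i) = form_sign R alt \<otimes> A $$ (i, j)"
    and "\<And>i. alt \<Longrightarrow> i < n \<Longrightarrow> A $$ (i, i) = \<zero>"
  shows "A \<in> form_mats R alt n"
  unfolding mem_form_mats using assms by blast

lemma form_mats_zero: "mat n n (\<lambda>_. \<zero>) \<in> form_mats R alt n"
  by (rule form_matsI) (auto simp: mats_def)

lemma form_mats_add:
  assumes "A \<in> form_mats R alt n" "B \<in> form_mats R alt n"
  shows "mat n n (\<lambda>ij. A $$ ij \<oplus> B $$ ij) \<in> form_mats R alt n"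
proof (rule form_matsI)
  have AB: "A \<in> mats R n n" "B \<in> mats R n n" using assms form_mats_in_mats by blast+
  then show "mat n n (\<lambda>ij. A $$ ij \<oplus> B $$ ij) \<in> mats R n n" by (auto simp: mats_def)
  fix i assume i: "i < n"
  then show "mat n n (\<lambda>ij. A $$ ij \<oplus> B $$ ij) $$ (i, i) = \<zero>" if alt
    using form_matsD(2)[OF assms(1) that i] form_matsD(2)[OF assms(2) that i] by simp
  fix j assume j: "j < n"
  have "A $$ (j, i) \<oplus> B $$ (j, i) = form_sign R alt \<otimes> (A $$ (i, j) \<oplus> B $$ (i, j))"
    unfolding form_matsD(1)[OF assms(1) i j] form_matsD(1)[OF assms(2) i j]
    using mats_closed[OF AB(1) i j] mats_closed[OF AB(2) i j] by (simp add: r_distr)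
  then show "mat n n (\<lambda>ij. A $$ ij \<oplus> B $$ ij) $$ (j, i)
      = form_sign R alt \<otimes> mat n n (\<lambda>ij. A $$ ij \<oplus> B $$ ij) $$ (i, j)"
    using i j by simp
qed

lemma form_mats_smult:
  assumes "A \<in> form_mats R alt n" "s \<in> carrier R"
  shows "mat n n (\<lambda>ij. s \<otimes> A $$ ij) \<in> form_mats R alt n"
proof (rule form_matsI)
  have A: "A \<in> mats R n n" using assms form_mats_in_mats by blast
  then show "mat n n (\<lambda>ij. s \<otimes> A $$ ij) \<in> mats R n n" using assms(2) by (auto simp: mats_def)
  fix i assume i: "i < n"
  then show "mat n n (\<lambda>ij. s \<otimes> A $$ ij) $$ (i, i) = \<zero>" if alt
    using form_matsD(2)[OF assms(1) that i] assms(2) by simp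
  fix j assume j: "j < n"
  have "s \<otimes> A $$ (j, i) = form_sign R alt \<otimes> (s \<otimes> A $$ (i, j))"
    unfolding form_matsD(1)[OF assms(1) i j]
    using mats_closed[OF A i j] assms(2) by (simp add: m_lcomm)
  then show "mat n n (\<lambda>ij. s \<otimes> A $$ ij) $$ (j, i) = form_sign R alt \<otimes> mat n n (\<lambda>ij. s \<otimes> A $$ ij) $$ (i, j)"
    using i j by simp
qed

section \<open>Closure properties of \<open>defect\<close>\<close>

lemma defect_mats: "defect R alt d e v w Q \<subseteq> mats R d e"
  by (auto simp: defect_def)

lemma mats_add: "x \<in> mats R d e \<Longrightarrow> y \<in> mats R d e \<Longrightarrow> mat d e (\<lambda>ij. x $$ ij \<oplus> y $$ ij) \<in> mats R d e"
  by (auto simp: mats_def)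

lemma mats_minus: "x \<in> mats R d e \<Longrightarrow> y \<in> mats R d e \<Longrightarrow> mat d e (\<lambda>ij. x $$ ij \<ominus> y $$ ij) \<in> mats R d e"
  by (auto simp: mats_def)

lemma mats_smult: "x \<in> mats R d e \<Longrightarrow> s \<in> carrier R \<Longrightarrow> mat d e (\<lambda>ij. s \<otimes> x $$ ij) \<in> mats R d e"
  by (auto simp: mats_def)

lemma col_add:
  assumes "v \<in> {..<d} \<rightarrow> carrier R" "x \<in> mats R d e" "y \<in> mats R d e" "j < e"
  shows "(\<Oplus>i\<in>{..<d}. v i \<otimes> mat d e (\<lambda>ij. x $$ ij \<oplus> y $$ ij) $$ (i, j))
    = (\<Oplus>i\<in>{..<d}. v i \<otimes> x $$ (i, j)) \<oplus> (\<Oplus>i\<in>{..<d}. v i \<otimes> y $$ (i, j))"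
proof -
  have "(\<Oplus>i\<in>{..<d}. v i \<otimes> mat d e (\<lambda>ij. x $$ ij \<oplus> y $$ ij) $$ (i, j))
    = (\<Oplus>i\<in>{..<d}. v i \<otimes> (x $$ (i, j) \<oplus> y $$ (i, j)))"
    using assms by (intro finsum_cong') (auto simp: mats_def)
  also have "\<dots> = (\<Oplus>i\<in>{..<d}. v i \<otimes> x $$ (i, j)) \<oplus> (\<Oplus>i\<in>{..<d}. v i \<otimes> y $$ (i, j))"
    using assms by (intro finsum_mult_add) (auto simp: mats_def)
  finally show ?thesis .
qed

lemma col_smult:
  assumes "v \<in> {..<d} \<rightarrow> carrier R" "x \<in> mats R d e" "s \<in> carrier R" "j < e"
  shows "(\<Oplus>i\<in>{..<d}. v i \<otimes> mat d e (\<lambda>ij. s \<otimes> x $$ ij) $$ (i, j)) = s \<otimes> (\<Oplus>i\<in>{..<d}. v i \<otimes> x $$ (i, j))"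
proof -
  have "(\<Oplus>i\<in>{..<d}. v i \<otimes> mat d e (\<lambda>ij. s \<otimes> x $$ ij) $$ (i, j))
    = (\<Oplus>i\<in>{..<d}. v i \<otimes> (s \<otimes> x $$ (i, j)))"
    using assms by (intro finsum_cong') (auto simp: mats_def)
  also have "\<dots> = s \<otimes> (\<Oplus>i\<in>{..<d}. v i \<otimes> x $$ (i, j))"
    using assms by (intro finsum_mult_left) (auto simp: mats_def)
  finally show ?thesis .
qed

lemma col_closed:
  assumes "v \<in> {..<d} \<rightarrow> carrier R" "x \<in> mats R d e" "j < e"
  shows "(\<Oplus>i\<in>{..<d}. v i \<otimes> x $$ (i, j)) \<in> carrier R"
  using assms by (intro finsum_closed) (auto simp: mats_def)

lemma transpose_mats: "x \<in> mats R d e \<Longrightarrow> transpose_mat x \<in> mats R e d"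
  by (auto simp: mats_def)

lemma transpose_mat_map:
  "transpose_mat (mat d e (\<lambda>ij. f (x $$ ij))) = mat e d (\<lambda>ij. f (transpose_mat x $$ ij))"
  if "x \<in> mats R d e"
  by (rule eq_matI) (use that in \<open>auto simp: mats_def\<close>)

lemma transpose_mat_map2:
  "transpose_mat (mat d e (\<lambda>ij. f (x $$ ij) (y $$ ij))) = mat e d (\<lambda>ij. f (transpose_mat x $$ ij) (transpose_mat y $$ ij))"
  if "x \<in> mats R d e" "y \<in> mats R d e"
  by (rule eq_matI) (use that in \<open>auto simp: mats_def\<close>)

text \<open>With \<open>transpose_mat x\<close> in the second family, both families are column sums
  of the same shape: the \<open>col_\<close> lemmas apply to each, and exchanging
  \<open>(d, v, a)\<close> with \<open>(e, w, b)\<close> becomes a visible symmetry.\<close>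

lemma mem_defect:
  assumes "v \<in> {..<d} \<rightarrow> carrier R" "w \<in> {..<e} \<rightarrow> carrier R"
  shows "x \<in> defect R alt d e v w Q \<longleftrightarrow> x \<in> mats R d e \<and> (\<exists>a\<in>form_mats R alt d. \<exists>b\<in>form_mats R alt e.
     (\<forall>j<e. (\<Oplus>i\<in>{..<d}. v i \<otimes> x $$ (i, j)) \<oplus> (\<Oplus>k\<in>{..<e}. w k \<otimes> b $$ (k, j)) \<in> Q) \<and>
     (\<forall>i<d. (\<Oplus>j\<in>{..<e}. w j \<otimes> transpose_mat x $$ (j, i)) \<oplus> (\<Oplus>k\<in>{..<d}. v k \<otimes> a $$ (k, i)) \<in> Q))"
proof -
  have "(\<Oplus>j\<in>{..<e}. w j \<otimes> transpose_mat x $$ (j, i)) = (\<Oplus>j\<in>{..<e}. w j \<otimes> x $$ (i, j))"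
    if "x \<in> mats R d e" "i < d" for i
    using that assms by (intro finsum_cong') (auto simp: mats_def)
  then show ?thesis unfolding defect_def by (simp cong: conj_cong)
qed

lemma defectE:
  assumes "v \<in> {..<d} \<rightarrow> carrier R" "w \<in> {..<e} \<rightarrow> carrier R" "x \<in> defect R alt d e v w Q"
  obtains a b where "x \<in> mats R d e" "a \<in> form_mats R alt d" "b \<in> form_mats R alt e"
    "\<And>j. j < e \<Longrightarrow> (\<Oplus>i\<in>{..<d}. v i \<otimes> x $$ (i, j)) \<oplus> (\<Oplus>k\<in>{..<e}. w k \<otimes> b $$ (k, j)) \<in> Q"
    "\<And>i. i < d \<Longrightarrow> (\<Oplus>j\<in>{..<e}. w j \<otimes> transpose_mat x $$ (j, i)) \<oplus> (\<Oplus>k\<in>{..<d}. v k \<otimes> a $$ (k, i)) \<in> Q"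
proof -
  obtain a b where "x \<in> mats R d e" "a \<in> form_mats R alt d" "b \<in> form_mats R alt e"
    and *: "\<forall>j<e. (\<Oplus>i\<in>{..<d}. v i \<otimes> x $$ (i, j)) \<oplus> (\<Oplus>k\<in>{..<e}. w k \<otimes> b $$ (k, j)) \<in> Q"
    "\<forall>i<d. (\<Oplus>j\<in>{..<e}. w j \<otimes> transpose_mat x $$ (j, i)) \<oplus> (\<Oplus>k\<in>{..<d}. v k \<otimes> a $$ (k, i)) \<in> Q"
    using assms(3)[unfolded mem_defect[OF assms(1,2)]] by (elim conjE bexE) (rule that)
  with *[rule_format] show thesis by (intro that)
qed

text \<open>The two families of conditions trade places, and so do the blocks \<open>a\<close> and
  \<open>b\<close>. This handles a pivot that lies in \<open>w\<close>.\<close>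

lemma defect_transpose:
  assumes "v \<in> {..<d} \<rightarrow> carrier R" "w \<in> {..<e} \<rightarrow> carrier R"
    and "x \<in> defect R alt d e v w Q"
  shows "transpose_mat x \<in> defect R alt e d w v Q"
proof -
  have x: "x \<in> mats R d e" using assms(3) defect_mats by blast
  have "transpose_mat (transpose_mat x) = x" by simp
  then show ?thesis
    using assms(3) transpose_mats[OF x] unfolding mem_defect[OF assms(1,2)] mem_defect[OF assms(2,1)]
    by (elim conjE bexE, intro conjI bexI) simp_all
qed

lemma defect_add:
  assumes v: "v \<in> {..<d} \<rightarrow> carrier R" and w: "w \<in> {..<e} \<rightarrow> carrier R"
    and "ideal Q R" "x \<in> defect R alt d e v w Q" "y \<in> defect R alt d e v w Q"
  shows "mat d e (\<lambda>ij. x $$ ij \<oplus> y $$ ij) \<in> defect R alt d e v w Q"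
proof -
  interpret Q: ideal Q R by fact
  obtain a b where x: "x \<in> mats R d e" "a \<in> form_mats R alt d" "b \<in> form_mats R alt e"
    "\<And>j. j < e \<Longrightarrow> (\<Oplus>i\<in>{..<d}. v i \<otimes> x $$ (i, j)) \<oplus> (\<Oplus>k\<in>{..<e}. w k \<otimes> b $$ (k, j)) \<in> Q"
    "\<And>i. i < d \<Longrightarrow> (\<Oplus>j\<in>{..<e}. w j \<otimes> transpose_mat x $$ (j, i)) \<oplus> (\<Oplus>k\<in>{..<d}. v k \<otimes> a $$ (k, i)) \<in> Q"
    by (rule defectE[OF v w assms(4)]) (rule that)
  obtain a' b' where y: "y \<in> mats R d e" "a' \<in> form_mats R alt d" "b' \<in> form_mats R alt e"
    "\<And>j. j < e \<Longrightarrow> (\<Oplus>i\<in>{..<d}. v i \<otimes> y $$ (i, j)) \<oplus> (\<Oplus>k\<in>{..<e}. w k \<otimes> b' $$ (k, j)) \<in> Q"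
    "\<And>i. i < d \<Longrightarrow> (\<Oplus>j\<in>{..<e}. w j \<otimes> transpose_mat y $$ (j, i)) \<oplus> (\<Oplus>k\<in>{..<d}. v k \<otimes> a' $$ (k, i)) \<in> Q"
    by (rule defectE[OF v w assms(5)]) (rule that)
  have ab: "a \<in> mats R d d" "a' \<in> mats R d d" "b \<in> mats R e e" "b' \<in> mats R e e"
    using x(2,3) y(2,3) form_mats_in_mats by blast+
  note tr = transpose_mats[OF x(1)] transpose_mats[OF y(1)]
  have swap: "(p \<oplus> q) \<oplus> (p' \<oplus> q') = (p \<oplus> p') \<oplus> (q \<oplus> q')"
    if "p \<in> carrier R" "q \<in> carrier R" "p' \<in> carrier R" "q' \<in> carrier R" for p q p' q'
    using that by (simp add: a_ac)
  show ?thesis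
    unfolding mem_defect[OF v w]
  proof (intro conjI bexI allI impI)
    show "mat d e (\<lambda>ij. x $$ ij \<oplus> y $$ ij) \<in> mats R d e" using x(1) y(1) by (rule mats_add)
    show "mat d d (\<lambda>ij. a $$ ij \<oplus> a' $$ ij) \<in> form_mats R alt d" using x(2) y(2) by (rule form_mats_add)
    show "mat e e (\<lambda>ij. b $$ ij \<oplus> b' $$ ij) \<in> form_mats R alt e" using x(3) y(3) by (rule form_mats_add)
    fix j assume j: "j < e"
    show "(\<Oplus>i\<in>{..<d}. v i \<otimes> mat d e (\<lambda>ij. x $$ ij \<oplus> y $$ ij) $$ (i, j)) \<oplus>
        (\<Oplus>k\<in>{..<e}. w k \<otimes> mat e e (\<lambda>ij. b $$ ij \<oplus> b' $$ ij) $$ (k, j)) \<in> Q"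
      unfolding col_add[OF v x(1) y(1) j] col_add[OF w ab(3,4) j]
      using Q.a_closed[OF x(4)[OF j] y(4)[OF j]]
        swap[OF col_closed[OF v x(1) j] col_closed[OF w ab(3) j] col_closed[OF v y(1) j] col_closed[OF w ab(4) j]]
      by simp
  next
    fix i assume i: "i < d"
    show "(\<Oplus>j\<in>{..<e}. w j \<otimes> transpose_mat (mat d e (\<lambda>ij. x $$ ij \<oplus> y $$ ij)) $$ (j, i)) \<oplus>
        (\<Oplus>k\<in>{..<d}. v k \<otimes> mat d d (\<lambda>ij. a $$ ij \<oplus> a' $$ ij) $$ (k, i)) \<in> Q"
      unfolding transpose_mat_map2[OF x(1) y(1)] col_add[OF w tr i] col_add[OF v ab(1,2) i]
      using Q.a_closed[OF x(5)[OF i] y(5)[OF i]]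
        swap[OF col_closed[OF w tr(1) i] col_closed[OF v ab(1) i] col_closed[OF w tr(2) i] col_closed[OF v ab(2) i]]
      by simp
  qed
qed

text \<open>Two sets \<open>Q\<close> and \<open>Q'\<close> are allowed so that multiplication by an
  element of \<open>P\<close> may raise the level from \<open>P\<^sup>k\<close> to the next
  power.\<close>

lemma defect_smult:
  assumes v: "v \<in> {..<d} \<rightarrow> carrier R" and w: "w \<in> {..<e} \<rightarrow> carrier R"
    and s: "s \<in> carrier R" and Q: "\<And>q. q \<in> Q \<Longrightarrow> s \<otimes> q \<in> Q'"
    and "x \<in> defect R alt d e v w Q"
  shows "mat d e (\<lambda>ij. s \<otimes> x $$ ij) \<in> defect R alt d e v w Q'"
proof -
  obtain a b where x: "x \<in> mats R d e" "a \<in> form_mats R alt d" "b \<in> form_mats R alt e"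
    "\<And>j. j < e \<Longrightarrow> (\<Oplus>i\<in>{..<d}. v i \<otimes> x $$ (i, j)) \<oplus> (\<Oplus>k\<in>{..<e}. w k \<otimes> b $$ (k, j)) \<in> Q"
    "\<And>i. i < d \<Longrightarrow> (\<Oplus>j\<in>{..<e}. w j \<otimes> transpose_mat x $$ (j, i)) \<oplus> (\<Oplus>k\<in>{..<d}. v k \<otimes> a $$ (k, i)) \<in> Q"
    by (rule defectE[OF v w assms(5)]) (rule that)
  have ab: "a \<in> mats R d d" "b \<in> mats R e e"
    using x(2,3) form_mats_in_mats by blast+
  note tr = transpose_mats[OF x(1)]
  show ?thesis
    unfolding mem_defect[OF v w]
  proof (intro conjI bexI allI impI)
    show "mat d e (\<lambda>ij. s \<otimes> x $$ ij) \<in> mats R d e" using x(1) s by (rule mats_smult)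
    show "mat d d (\<lambda>ij. s \<otimes> a $$ ij) \<in> form_mats R alt d" using x(2) s by (rule form_mats_smult)
    show "mat e e (\<lambda>ij. s \<otimes> b $$ ij) \<in> form_mats R alt e" using x(3) s by (rule form_mats_smult)
    fix j assume j: "j < e"
    show "(\<Oplus>i\<in>{..<d}. v i \<otimes> mat d e (\<lambda>ij. s \<otimes> x $$ ij) $$ (i, j)) \<oplus>
        (\<Oplus>k\<in>{..<e}. w k \<otimes> mat e e (\<lambda>ij. s \<otimes> b $$ ij) $$ (k, j)) \<in> Q'"
      unfolding col_smult[OF v x(1) s j] col_smult[OF w ab(2) s j]
      using Q[OF x(4)[OF j]] r_distr[OF col_closed[OF v x(1) j] col_closed[OF w ab(2) j] s] by simp
  next
    fix i assume i: "i < d"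
    show "(\<Oplus>j\<in>{..<e}. w j \<otimes> transpose_mat (mat d e (\<lambda>ij. s \<otimes> x $$ ij)) $$ (j, i)) \<oplus>
        (\<Oplus>k\<in>{..<d}. v k \<otimes> mat d d (\<lambda>ij. s \<otimes> a $$ ij) $$ (k, i)) \<in> Q'"
      unfolding transpose_mat_map[OF x(1)] col_smult[OF w tr s i] col_smult[OF v ab(1) s i]
      using Q[OF x(5)[OF i]] r_distr[OF col_closed[OF w tr i] col_closed[OF v ab(1) i] s] by simp
  qed
qed


text \<open>In the alternating case the diagonal block \<open>- s (E \<mu> i - E i \<mu>)\<close> is used, in the symmetric case
  \<open>- s (E \<mu> i + E i \<mu>) + 2 s (t i) E \<mu> \<mu>\<close>.\<close>

lemma form_mats_solve:
  assumes v: "v \<in> {..<d} \<rightarrow> carrier R" and t: "t \<in> {..<d} \<rightarrow> carrier R"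
    and \<mu>: "\<mu> < d" and vt: "\<forall>i<d. v i = t i \<otimes> v \<mu>"
    and i: "i < d" and s: "s \<in> carrier R"
  shows "\<exists>a\<in>form_mats R alt d. \<forall>l<d.
    ((if l = i then s \<otimes> v \<mu> else \<zero>) \<oplus> (if l = \<mu> then \<ominus> (t i) \<otimes> (s \<otimes> v \<mu>) else \<zero>))
      \<oplus> (\<Oplus>k\<in>{..<d}. v k \<otimes> a $$ (k, l)) = \<zero>"
proof -
  \<comment> \<open>The entry \<open>\<ominus> s\<close> at \<open>(\<mu>, i)\<close> clears column
    \<open>i\<close>, and \<open>q\<close> is its forced mirror image at \<open>(i, \<mu>)\<close>.
    Column \<open>\<mu>\<close> then needs \<open>v i \<otimes> q \<oplus> v \<mu> \<otimes> z = t i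
    \<otimes> (s \<otimes> v \<mu>)\<close>. In the alternating case \<open>q\<close> alone achieves
    this, as \<open>v i = t i \<otimes> v \<mu>\<close>; in the symmetric case it has the wrong
    sign, and the diagonal entry \<open>z\<close> makes up twice the amount.\<close>
  define q where "q = (if alt then s else \<ominus> s)"
  define z where "z = (if alt then \<zero> else (s \<otimes> t i) \<oplus> (s \<otimes> t i))"
  have vc: "v l \<in> carrier R" "t l \<in> carrier R" if "l < d" for l using Pi_mem[OF v, of l] Pi_mem[OF t, of l] that by simp_all
  have q: "q \<in> carrier R" "z \<in> carrier R" using s vc(2)[OF i] by (auto simp: q_def z_def)
  \<comment> \<open>The three contributions are added, so that they may overlap when
    \<open>i = \<mu>\<close>.\<close>
  let ?a = "\<lambda>k l. (if k = \<mu> \<and> l = i then \<ominus> s else \<zero>) \<oplus>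
    ((if k = i \<and> l = \<mu> then q else \<zero>) \<oplus> (if k = \<mu> \<and> l = \<mu> then z else \<zero>))"
  let ?A = "mat d d (\<lambda>(k, l). ?a k l)"
  \<comment> \<open>Transposition swaps the first two position tests and fixes the third, so the
    sign rule becomes a check over truth values.\<close>
  have g: "((if b2 then \<ominus> s else \<zero>) \<oplus> ((if b1 then q else \<zero>) \<oplus> (if b3 then z else \<zero>)))
      = form_sign R alt \<otimes> ((if b1 then \<ominus> s else \<zero>) \<oplus> ((if b2 then q else \<zero>) \<oplus> (if b3 then z else \<zero>)))" for b1 b2 b3
  proof (cases alt)
    case True
    then show ?thesis using s
      by (cases b1; cases b2) (simp_all add: q_def z_def form_sign_def l_minus l_neg r_neg)
  next
    case False
    then show ?thesis using s q(2)
      by (cases b1; cases b2; cases b3) (simp_all add: q_def form_sign_def a_ac)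
  qed
  have Am: "?A \<in> mats R d d" using s q by (auto simp: mats_def)
  have As: "?a l k = form_sign R alt \<otimes> ?a k l" for k l
    using g[of "k = i \<and> l = \<mu>" "k = \<mu> \<and> l = i" "k = \<mu> \<and> l = \<mu>"] by (simp only: conj_commute)
  have Az: "?a k k = \<zero>" if alt for k
    using s that by (simp add: q_def z_def l_neg conj_commute)
  have A: "?A \<in> form_mats R alt d"
  proof (rule form_matsI)
    show "?A \<in> mats R d d" by (fact Am)
    show "?A $$ (l, k) = form_sign R alt \<otimes> ?A $$ (k, l)" if "k < d" "l < d" for k l
      using that As[of l k] by simp
    show "?A $$ (k, k) = \<zero>" if alt "k < d" for k
      using that Az[of k] by simp
  qed
  have sum: "(\<Oplus>k\<in>{..<d}. v k \<otimes> ?A $$ (k, l)) = (if l = i then v \<mu> \<otimes> (\<ominus> s) else \<zero>) \<oplus>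
      ((if l = \<mu> then v i \<otimes> q else \<zero>) \<oplus> (if l = \<mu> then v \<mu> \<otimes> z else \<zero>))" if l: "l < d" for l
  proof -
    have "(\<Oplus>k\<in>{..<d}. v k \<otimes> ?A $$ (k, l)) = (\<Oplus>k\<in>{..<d}. v k \<otimes> ?a k l)"
      using l v s q by (intro finsum_cong') auto
    also have "\<dots> = (\<Oplus>k\<in>{..<d}. v k \<otimes> (if k = \<mu> \<and> l = i then \<ominus> s else \<zero>)) \<oplus>
        (\<Oplus>k\<in>{..<d}. v k \<otimes> ((if k = i \<and> l = \<mu> then q else \<zero>) \<oplus> (if k = \<mu> \<and> l = \<mu> then z else \<zero>)))"
      using l v s q by (intro finsum_mult_add) auto
    also have "(\<Oplus>k\<in>{..<d}. v k \<otimes> ((if k = i \<and> l = \<mu> then q else \<zero>) \<oplus> (if k = \<mu> \<and> l = \<mu> then z else \<zero>)))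
        = (\<Oplus>k\<in>{..<d}. v k \<otimes> (if k = i \<and> l = \<mu> then q else \<zero>)) \<oplus> (\<Oplus>k\<in>{..<d}. v k \<otimes> (if k = \<mu> \<and> l = \<mu> then z else \<zero>))"
      using l v s q by (intro finsum_mult_add) auto
    also have "(\<Oplus>k\<in>{..<d}. v k \<otimes> (if k = \<mu> \<and> l = i then \<ominus> s else \<zero>)) = (if l = i then v \<mu> \<otimes> (\<ominus> s) else \<zero>)"
      using v s \<mu> by (intro finsum_delta) auto
    also have "(\<Oplus>k\<in>{..<d}. v k \<otimes> (if k = i \<and> l = \<mu> then q else \<zero>)) = (if l = \<mu> then v i \<otimes> q else \<zero>)"
      using v q i by (intro finsum_delta) auto
    also have "(\<Oplus>k\<in>{..<d}. v k \<otimes> (if k = \<mu> \<and> l = \<mu> then z else \<zero>)) = (if l = \<mu> then v \<mu> \<otimes> z else \<zero>)"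
      using v q \<mu> by (intro finsum_delta) auto
    finally show ?thesis .
  qed
  \<comment> \<open>The terms with the test \<open>l = i\<close> cancel among themselves, and so do
    those with \<open>l = \<mu>\<close>; this covers \<open>i = \<mu>\<close> as well.\<close>
  have zero: "((if l = i then s \<otimes> v \<mu> else \<zero>) \<oplus> (if l = \<mu> then \<ominus> (t i) \<otimes> (s \<otimes> v \<mu>) else \<zero>))
      \<oplus> ((if l = i then v \<mu> \<otimes> (\<ominus> s) else \<zero>) \<oplus>
      ((if l = \<mu> then v i \<otimes> q else \<zero>) \<oplus> (if l = \<mu> then v \<mu> \<otimes> z else \<zero>))) = \<zero>" for l
  proof -
    define p p' x r r' where "p = (if l = i then s \<otimes> v \<mu> else \<zero>)"
      and "p' = (if l = i then v \<mu> \<otimes> (\<ominus> s) else \<zero>)"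
      and "x = t i \<otimes> (s \<otimes> v \<mu>)"
      and "r = (if l = \<mu> then \<ominus> (t i) \<otimes> (s \<otimes> v \<mu>) else \<zero>)"
      and "r' = (if l = \<mu> then v i \<otimes> q else \<zero>) \<oplus> (if l = \<mu> then v \<mu> \<otimes> z else \<zero>)"
    have closed: "p \<in> carrier R" "p' \<in> carrier R" "r \<in> carrier R" "r' \<in> carrier R" "x \<in> carrier R"
      using vc(1)[OF \<mu>] vc(1)[OF i] vc(2)[OF i] s q by (auto simp: p_def p'_def r_def r'_def x_def)
    have 1: "p \<oplus> p' = \<zero>"
      using vc(1)[OF \<mu>] s by (auto simp: p_def p'_def r_minus m_comm r_neg)
    have vi: "v i \<otimes> s = x" "v \<mu> \<otimes> (s \<otimes> t i) = x"
      using vt[rule_format, OF i] vc(1)[OF \<mu>] vc(2)[OF i] s by (simp_all add: x_def m_ac)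
    have 2: "r \<oplus> r' = \<zero>"
    proof (cases "l = \<mu>")
      case True
      have "v i \<otimes> q \<oplus> v \<mu> \<otimes> z = x"
      proof (cases alt)
        case True
        then show ?thesis using vi vc(1)[OF \<mu>] closed by (simp add: q_def z_def)
      next
        case False
        then show ?thesis
          using vi vc(1)[OF \<mu>] vc(1)[OF i] s vc(2)[OF i] closed
          by (simp add: q_def z_def r_minus r_distr a_assoc[symmetric] l_neg)
      qed
      then show ?thesis
        using True vc(2)[OF i] s vc(1)[OF \<mu>] closed by (simp add: r_def r'_def l_minus l_neg x_def)
    qed (simp add: r_def r'_def)
    have "(p \<oplus> r) \<oplus> (p' \<oplus> r') = (p \<oplus> p') \<oplus> (r \<oplus> r')"
      using closed by (simp add: a_ac)
    then show ?thesis
      using 1 2 by (simp add: p_def p'_def r_def r'_def)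
  qed
  show ?thesis
  proof (intro bexI[OF _ A] allI impI)
    fix l assume "l < d"
    then show "((if l = i then s \<otimes> v \<mu> else \<zero>) \<oplus> (if l = \<mu> then \<ominus> (t i) \<otimes> (s \<otimes> v \<mu>) else \<zero>))
      \<oplus> (\<Oplus>k\<in>{..<d}. v k \<otimes> ?A $$ (k, l)) = \<zero>"
      unfolding sum[OF \<open>l < d\<close>] by (intro zero)
  qed
qed

text \<open>The vector \<open>v\<close> annihilates this matrix because
  \<open>v i = t i \<otimes> v \<mu>\<close>, so \<open>b\<close> can be zero. The products of
  \<open>w\<close> with the transpose are \<open>w j\<close> at position \<open>i\<close> and
  \<open>\<ominus> (t i) \<otimes> w j\<close> at position \<open>\<mu>\<close>; since
  \<open>v \<mu>\<close> divides \<open>w j\<close>, they are cancelled by the block from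
  \<open>form_mats_solve\<close>. All sums are exactly zero, whence the result for every ideal
  \<open>Q\<close>.\<close>

lemma elem_mat_diff_in_defect:
  assumes v: "v \<in> {..<d} \<rightarrow> carrier R" and w: "w \<in> {..<e} \<rightarrow> carrier R"
    and t: "t \<in> {..<d} \<rightarrow> carrier R"
    and \<mu>: "\<mu> < d" and vt: "\<forall>i<d. v i = t i \<otimes> v \<mu>"
    and ij: "i < d" "j < e" and s: "s \<in> carrier R" "w j = s \<otimes> v \<mu>"
    and "ideal Q R"
  shows "mat d e (\<lambda>p. elem_mat R d e i j $$ p \<oplus> \<ominus> (t i) \<otimes> elem_mat R d e \<mu> j $$ p) \<in> defect R alt d e v w Q"
    (is "?x \<in> _")
proof -
  interpret Q: ideal Q R by fact
  obtain a where a: "a \<in> form_mats R alt d" "\<forall>l<d.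
    ((if l = i then s \<otimes> v \<mu> else \<zero>) \<oplus> (if l = \<mu> then \<ominus> (t i) \<otimes> (s \<otimes> v \<mu>) else \<zero>))
      \<oplus> (\<Oplus>k\<in>{..<d}. v k \<otimes> a $$ (k, l)) = \<zero>"
    by (rule bexE[OF form_mats_solve[OF v t \<mu> vt ij(1) s(1), of alt]]) (rule that)
  have vc: "v l \<in> carrier R" "t l \<in> carrier R" if "l < d" for l using Pi_mem[OF v, of l] Pi_mem[OF t, of l] that by simp_all
  have ti: "\<ominus> (t i) \<in> carrier R" using vc ij by simp
  have x: "?x \<in> mats R d e"
    using ti by (auto simp: mats_def elem_mat_def)
  have col: "(\<Oplus>k\<in>{..<d}. v k \<otimes> ?x $$ (k, l)) = \<zero>" if l: "l < e" for l
  proof -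
    have "(\<Oplus>k\<in>{..<d}. v k \<otimes> ?x $$ (k, l)) = (\<Oplus>k\<in>{..<d}. v k \<otimes> ((if k = i \<and> l = j then \<one> else \<zero>)
        \<oplus> (if k = \<mu> \<and> l = j then \<ominus> (t i) else \<zero>)))"
      using l v ti by (intro finsum_cong') (auto simp: elem_mat_def)
    also have "\<dots> = (\<Oplus>k\<in>{..<d}. v k \<otimes> (if k = i \<and> l = j then \<one> else \<zero>))
        \<oplus> (\<Oplus>k\<in>{..<d}. v k \<otimes> (if k = \<mu> \<and> l = j then \<ominus> (t i) else \<zero>))"
      using v ti by (intro finsum_mult_add) auto
    also have "(\<Oplus>k\<in>{..<d}. v k \<otimes> (if k = i \<and> l = j then \<one> else \<zero>)) = (if l = j then v i \<otimes> \<one> else \<zero>)"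
      using v ij by (intro finsum_delta) auto
    also have "(\<Oplus>k\<in>{..<d}. v k \<otimes> (if k = \<mu> \<and> l = j then \<ominus> (t i) else \<zero>)) = (if l = j then v \<mu> \<otimes> \<ominus> (t i) else \<zero>)"
      using v \<mu> ti by (intro finsum_delta) auto
    also have "(if l = j then v i \<otimes> \<one> else \<zero>) \<oplus> (if l = j then v \<mu> \<otimes> \<ominus> (t i) else \<zero>) = \<zero>"
      using vt[rule_format, OF ij(1)] vc(1)[OF \<mu>] vc(2)[OF ij(1)] by (simp add: r_minus m_comm r_neg)
    finally show ?thesis .
  qed
  have row: "(\<Oplus>k\<in>{..<e}. w k \<otimes> transpose_mat ?x $$ (k, l))
      = (if l = i then s \<otimes> v \<mu> else \<zero>) \<oplus> (if l = \<mu> then \<ominus> (t i) \<otimes> (s \<otimes> v \<mu>) else \<zero>)" if l: "l < d" for l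
  proof -
    have "(\<Oplus>k\<in>{..<e}. w k \<otimes> transpose_mat ?x $$ (k, l)) = (\<Oplus>k\<in>{..<e}. w k \<otimes> ((if k = j \<and> l = i then \<one> else \<zero>)
        \<oplus> (if k = j \<and> l = \<mu> then \<ominus> (t i) else \<zero>)))"
      using l w ti by (intro finsum_cong') (auto simp: elem_mat_def)
    also have "\<dots> = (\<Oplus>k\<in>{..<e}. w k \<otimes> (if k = j \<and> l = i then \<one> else \<zero>))
        \<oplus> (\<Oplus>k\<in>{..<e}. w k \<otimes> (if k = j \<and> l = \<mu> then \<ominus> (t i) else \<zero>))"
      using w ti by (intro finsum_mult_add) auto
    also have "(\<Oplus>k\<in>{..<e}. w k \<otimes> (if k = j \<and> l = i then \<one> else \<zero>)) = (if l = i then w j \<otimes> \<one> else \<zero>)"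
      using w ij by (intro finsum_delta) auto
    also have "(\<Oplus>k\<in>{..<e}. w k \<otimes> (if k = j \<and> l = \<mu> then \<ominus> (t i) else \<zero>)) = (if l = \<mu> then w j \<otimes> \<ominus> (t i) else \<zero>)"
      using w ij ti by (intro finsum_delta) auto
    finally show ?thesis
      using s vc(1)[OF \<mu>] ti by (simp add: m_comm[of "s \<otimes> v \<mu>"])
  qed
  have zero: "(\<Oplus>k\<in>{..<e}. w k \<otimes> mat e e (\<lambda>_. \<zero>) $$ (k, l)) = \<zero>" if "l < e" for l
    using that by (intro finsum_zero_terms) (auto simp: Pi_mem[OF w])
  have zQ: "\<zero> \<in> Q" by (rule Q.zero_closed)
  show ?thesis
    unfolding mem_defect[OF v w]
    by (intro conjI x bexI[OF _ a(1)] bexI[OF _ form_mats_zero[of e alt]] allI impI)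
      (simp_all only: col row zero a(2)[rule_format] zQ l_zero[OF zero_closed])
qed

end

lemma transpose_elem_mat: "i < d \<Longrightarrow> j < e \<Longrightarrow> transpose_mat (elem_mat R d e i j) = elem_mat R e d j i"
  by (rule eq_matI) (auto simp: elem_mat_def)

context cring
begin

text \<open>Modulo \<open>V\<close> the matrix \<open>E\<close> equals \<open>t\<close> times
  \<open>F\<close>. A unit \<open>t\<close> can be cancelled, and a nonunit \<open>t\<close> sends
  \<open>F\<close> into \<open>V\<close>. For \<open>E\<close> at \<open>(i, j)\<close>,
  \<open>F\<close> at \<open>(\<mu>, j)\<close> and \<open>t\<close> depending on \<open>i\<close>
  only, this splits the condition on the cell into one on its row and one on its column.\<close>

lemma elem_mat_notin_iff:
  assumes "submodule V R (mat_module R d e)"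
    and E: "E \<in> mats R d e" and F: "F \<in> mats R d e" and t: "t \<in> carrier R"
    and diff: "mat d e (\<lambda>ij. E $$ ij \<oplus> \<ominus> t \<otimes> F $$ ij) \<in> V" (is "?G \<in> V")
    and nonunit: "t \<notin> Units R \<Longrightarrow> mat d e (\<lambda>ij. t \<otimes> F $$ ij) \<in> V"
  shows "E \<notin> V \<longleftrightarrow> t \<in> Units R \<and> F \<notin> V"
proof -
  note V_add = mats_submoduleD(2)[OF assms(1)] and V_smult = mats_submoduleD(3)[OF assms(1)]
  let ?tF = "mat d e (\<lambda>ij. t \<otimes> F $$ ij)"
  have E_eq: "mat d e (\<lambda>ij. ?G $$ ij \<oplus> ?tF $$ ij) = E"
    by (rule eq_matI) (use E F t in \<open>auto simp: mats_def a_assoc l_minus l_neg\<close>)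
  have tF_eq: "mat d e (\<lambda>ij. E $$ ij \<oplus> mat d e (\<lambda>ij. \<ominus> \<one> \<otimes> ?G $$ ij) $$ ij) = ?tF"
    by (rule eq_matI) (use E F t in \<open>auto simp: mats_def l_minus minus_add r_neg1 r_neg2\<close>)
  have F_eq: "mat d e (\<lambda>ij. inv t \<otimes> ?tF $$ ij) = F" if "t \<in> Units R"
    by (rule eq_matI) (use F that in \<open>auto simp: mats_def m_assoc[symmetric] Units_closed\<close>)
  have 1: "E \<in> V" if "?tF \<in> V" using V_add[OF diff that] unfolding E_eq .
  have 2: "?tF \<in> V" if "E \<in> V"
    using V_add[OF that V_smult[OF _ diff, of "\<ominus> \<one>"]] unfolding tF_eq by simp
  have 3: "F \<in> V" if "t \<in> Units R" "?tF \<in> V"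
    using V_smult[OF Units_inv_closed[OF that(1)] that(2)] unfolding F_eq[OF that(1)] .
  show ?thesis using 1 2 3 V_smult[OF t] nonunit by blast
qed

lemma defect_zero:
  assumes v: "v \<in> {..<d} \<rightarrow> carrier R" and w: "w \<in> {..<e} \<rightarrow> carrier R" and "ideal Q R"
  shows "mat d e (\<lambda>_. \<zero>) \<in> defect R alt d e v w Q"
proof -
  have zQ: "\<zero> \<in> Q" using assms(3) by (simp add: additive_subgroup.zero_closed ideal.axioms(1))
  have z: "(\<Oplus>i\<in>{..<d}. v i \<otimes> mat d e (\<lambda>_. \<zero>) $$ (i, j)) = \<zero>" if "j < e" "v \<in> {..<d} \<rightarrow> carrier R" for d e j v
    using that(1) by (intro finsum_zero_terms) (auto simp: Pi_mem[OF that(2)])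
  have tr: "transpose_mat (mat d e (\<lambda>_. \<zero>)) = mat e d (\<lambda>_. \<zero>)" by (rule eq_matI) auto
  show ?thesis
    unfolding mem_defect[OF v w] tr
    by (intro conjI bexI[OF _ form_mats_zero[of d alt]] bexI[OF _ form_mats_zero[of e alt]] allI impI)
      (simp_all only: z v w zQ l_zero[OF zero_closed], auto simp: mats_def)
qed

text \<open>The start of the induction on the level: the zeroth power of \<open>P\<close> is the
  whole ring, and zero diagonal blocks will do.\<close>

lemma defect_carrier:
  assumes v: "v \<in> {..<d} \<rightarrow> carrier R" and w: "w \<in> {..<e} \<rightarrow> carrier R" and x: "x \<in> mats R d e"
  shows "x \<in> defect R alt d e v w (carrier R)"
proof -
  have z: "mat n n (\<lambda>_. \<zero>) \<in> mats R n n" for n by (auto simp: mats_def)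
  show ?thesis
    unfolding mem_defect[OF v w]
    by (intro conjI bexI[OF _ form_mats_zero[of d alt]] bexI[OF _ form_mats_zero[of e alt]] allI impI
        a_closed col_closed v w x z transpose_mats) (simp_all only: x z)
qed

end

section \<open>All matrices as \<open>Rel\<close> plus \<open>defect\<close>, level by level\<close>

context discrete_valuation_ring
begin

lemma ideal_ideal_pow: "ideal (ideal_pow R P k) R"
  using ideal_pow_ideal[OF ideal_P] .

lemma mult_ideal_pow_Suc:
  assumes "s \<in> P" "q \<in> ideal_pow R P k"
  shows "s \<otimes> q \<in> ideal_pow R P (Suc k)"
proof -
  have "s \<in> carrier R" "q \<in> carrier R"
    using assms ideal.Icarr[OF ideal_P] ideal.Icarr[OF ideal_ideal_pow] by auto
  moreover have "q \<otimes> s \<in> ideal_prod R (ideal_pow R P k) P"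
    using assms by (intro ideal_prod.prod)
  ultimately show ?thesis by (simp add: ideals_set_def m_comm)
qed

text \<open>Nakayama's lemma, one step at a time: \<open>V\<close> is \<open>Rel + defect\<close> at level \<open>k + 1\<close>, and the induction
  hypothesis puts \<open>P\<close> times any matrix into \<open>V\<close>. If \<open>v \<mu>\<close> has minimal valuation among all entries of
  \<open>(v, w)\<close> and \<open>v i = t i v \<mu>\<close>, then \<open>E i j - t i E \<mu> j\<close> lies in \<open>V\<close>. Hence the cells whose
  elementary matrix is not in \<open>V\<close> form a rectangle.\<close>

lemma Rel_plus_defect:
  assumes col: "partial_colouring d e C \<A>" and adm: "admissible d e C \<A>" and u: "u \<in> mats R d e"
    and units: "\<forall>i<d. \<forall>j<e. u $$ (i, j) \<in> Units R" and "d + e > 0"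
    and v: "v \<in> {..<d} \<rightarrow> carrier R" and w: "w \<in> {..<e} \<rightarrow> carrier R" and x: "x \<in> mats R d e"
  shows "\<exists>y\<in>defect R alt d e v w (ideal_pow R P k). mat d e (\<lambda>ij. x $$ ij \<ominus> y $$ ij) \<in> Rel R d e C \<A> u"
  using x
proof (induction k arbitrary: x)
  case 0
  have "mat d e (\<lambda>ij. x $$ ij \<ominus> x $$ ij) = mat d e (\<lambda>_. \<zero>)"
    by (rule eq_matI) (use 0 in \<open>auto simp: mats_def a_minus_def r_neg\<close>)
  moreover have "x \<in> defect R alt d e v w (ideal_pow R P 0)"
    using defect_carrier[OF v w 0] by (simp add: ideals_set_def)
  ultimately show ?case using zero_in_Rel[OF col u] by metis
next
  case (Suc k)
  let ?K = "defect R alt d e v w (ideal_pow R P (Suc k))"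
  let ?Rel = "Rel R d e C \<A> u"
  define V where "V = {x \<in> mats R d e. \<exists>y\<in>?K. mat d e (\<lambda>ij. x $$ ij \<ominus> y $$ ij) \<in> ?Rel}"
  have V_mats: "V \<subseteq> mats R d e" by (auto simp: V_def)
  have V_I: "x \<in> V" if "x \<in> mats R d e" "y \<in> ?K" "mat d e (\<lambda>ij. x $$ ij \<ominus> y $$ ij) \<in> ?Rel" for x y
    using that unfolding V_def by blast
  have V_add: "mat d e (\<lambda>ij. x $$ ij \<oplus> x' $$ ij) \<in> V" if xV: "x \<in> V" "x' \<in> V" for x x'
  proof -
    obtain y where y: "y \<in> ?K" "mat d e (\<lambda>ij. x $$ ij \<ominus> y $$ ij) \<in> ?Rel"
      using xV(1) unfolding V_def by blast
    obtain y' where y': "y' \<in> ?K" "mat d e (\<lambda>ij. x' $$ ij \<ominus> y' $$ ij) \<in> ?Rel"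
      using xV(2) unfolding V_def by blast
    have m: "x \<in> mats R d e" "x' \<in> mats R d e" "y \<in> mats R d e" "y' \<in> mats R d e"
      using xV y(1) y'(1) V_mats defect_mats by blast+
    let ?y = "mat d e (\<lambda>ij. y $$ ij \<oplus> y' $$ ij)"
    have "mat d e (\<lambda>ij. mat d e (\<lambda>ij. x $$ ij \<oplus> x' $$ ij) $$ ij \<ominus> ?y $$ ij)
        = mat d e (\<lambda>ij. mat d e (\<lambda>ij. x $$ ij \<ominus> y $$ ij) $$ ij \<oplus> mat d e (\<lambda>ij. x' $$ ij \<ominus> y' $$ ij) $$ ij)"
      by (rule eq_matI) (use m in \<open>auto simp: mats_def a_minus_def a_ac minus_add\<close>)
    then have "mat d e (\<lambda>ij. mat d e (\<lambda>ij. x $$ ij \<oplus> x' $$ ij) $$ ij \<ominus> ?y $$ ij) \<in> ?Rel"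
      using Rel_add[OF col u y(2) y'(2)] by simp
    then show ?thesis
      using defect_add[OF v w ideal_ideal_pow y(1) y'(1)] mats_add[OF m(1,2)] unfolding V_def by blast
  qed
  \<comment> \<open>Used twice: with \<open>Q\<close> at level \<open>k + 1\<close> and any scalar,
    for closure of \<open>V\<close>, and with \<open>Q\<close> at level \<open>k\<close> and a
    scalar from \<open>P\<close>, for the Nakayama step.\<close>
  have smult: "mat d e (\<lambda>ij. s \<otimes> x $$ ij) \<in> V"
    if "s \<in> carrier R" "x \<in> mats R d e" "y \<in> defect R alt d e v w Q"
      "mat d e (\<lambda>ij. x $$ ij \<ominus> y $$ ij) \<in> ?Rel"
      and Q: "\<And>q. q \<in> Q \<Longrightarrow> s \<otimes> q \<in> ideal_pow R P (Suc k)" for s x y Q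
  proof -
    have m: "y \<in> mats R d e" using that(3) defect_mats by blast
    let ?y = "mat d e (\<lambda>ij. s \<otimes> y $$ ij)"
    have "mat d e (\<lambda>ij. mat d e (\<lambda>ij. s \<otimes> x $$ ij) $$ ij \<ominus> ?y $$ ij)
        = mat d e (\<lambda>ij. s \<otimes> mat d e (\<lambda>ij. x $$ ij \<ominus> y $$ ij) $$ ij)"
      by (rule eq_matI) (use m that(1,2) in \<open>auto simp: mats_def a_minus_def r_distr r_minus\<close>)
    then have "mat d e (\<lambda>ij. mat d e (\<lambda>ij. s \<otimes> x $$ ij) $$ ij \<ominus> ?y $$ ij) \<in> ?Rel"
      using Rel_smult[OF col u that(4,1)] by simp
    then show ?thesis
      using defect_smult[OF v w that(1) Q that(3)] mats_smult[OF that(2,1)] unfolding V_def by blast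
  qed
  have V_smult: "mat d e (\<lambda>ij. s \<otimes> x $$ ij) \<in> V" if s: "s \<in> carrier R" and x: "x \<in> V" for s x
  proof -
    obtain y where y: "x \<in> mats R d e" "y \<in> ?K" "mat d e (\<lambda>ij. x $$ ij \<ominus> y $$ ij) \<in> ?Rel"
      using x unfolding V_def by blast
    show ?thesis
      by (rule smult[OF s y]) (rule ideal.I_l_closed[OF ideal_ideal_pow _ s])
  qed
  have P_V: "mat d e (\<lambda>ij. s \<otimes> x $$ ij) \<in> V" if s: "s \<in> P" and x: "x \<in> mats R d e" for s x
  proof -
    obtain y where y: "y \<in> defect R alt d e v w (ideal_pow R P k)" "mat d e (\<lambda>ij. x $$ ij \<ominus> y $$ ij) \<in> ?Rel"
      using Suc.IH[OF x] by blast
    show ?thesis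
      by (rule smult[OF ideal.Icarr[OF ideal_P s] x y]) (rule mult_ideal_pow_Suc[OF s])
  qed
  have Rel_V: "?Rel \<subseteq> V"
  proof
    fix x assume x: "x \<in> ?Rel"
    then have m: "x \<in> mats R d e" using Rel_in_mats by blast
    have "mat d e (\<lambda>ij. x $$ ij \<ominus> mat d e (\<lambda>_. \<zero>) $$ ij) = x"
      by (rule eq_matI) (use m in \<open>auto simp: mats_def a_minus_def\<close>)
    then have "mat d e (\<lambda>ij. x $$ ij \<ominus> mat d e (\<lambda>_. \<zero>) $$ ij) \<in> ?Rel"
      using x by simp
    then show "x \<in> V" by (rule V_I[OF m defect_zero[OF v w ideal_ideal_pow]])
  qed
  have K_V: "x \<in> V" if x: "x \<in> ?K" for x
  proof -
    have m: "x \<in> mats R d e" using x defect_mats by blast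
    have "mat d e (\<lambda>ij. x $$ ij \<ominus> x $$ ij) = mat d e (\<lambda>_. \<zero>)"
      by (rule eq_matI) (use m in \<open>auto simp: mats_def a_minus_def r_neg\<close>)
    then have "mat d e (\<lambda>ij. x $$ ij \<ominus> x $$ ij) \<in> ?Rel" using zero_in_Rel[OF col u] by simp
    then show ?thesis using x m unfolding V_def by blast
  qed
  have V: "submodule V R (mat_module R d e)"
    using V_mats V_add V_smult Rel_V zero_in_Rel[OF col u] by (intro mats_submoduleI) auto
  note notin = elem_mat_notin_iff[OF V elem_mat_in_mats elem_mat_in_mats]
  let ?E = "elem_mat R d e"
  \<comment> \<open>The pivot must divide the entries of both halves, so these are joined before the
    minimum is taken.\<close>
  define y where "y i = (if i < d then v i else w (i - d))" for i
  have y_closed: "y ` {..<d + e} \<subseteq> carrier R"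
    using Pi_mem[OF v] Pi_mem[OF w] by (auto simp: y_def)
  obtain \<mu> where \<mu>: "\<mu> < d + e" "\<forall>i<d + e. y \<mu> divides y i"
    using finite_has_common_divisor[OF _ _ y_closed] \<open>d + e > 0\<close> by fastforce
  have div: "\<exists>s\<in>carrier R. y i = s \<otimes> y \<mu>" if i: "i < d + e" for i
  proof -
    have "y \<mu> divides y i" using \<mu>(2) i by blast
    then obtain s where s: "y i = y \<mu> \<otimes> s" "s \<in> carrier R" by (rule dividesE)
    moreover have "y \<mu> \<in> carrier R" using y_closed \<mu>(1) by blast
    ultimately show ?thesis by (auto simp: m_comm)
  qed
  have div_v: "\<exists>s\<in>carrier R. v i = s \<otimes> y \<mu>" if "i < d" for i using div[of i] that by (simp add: y_def[of i])
  have div_w: "\<exists>s\<in>carrier R. w j = s \<otimes> y \<mu>" if "j < e" for j using div[of "d + j"] that by (simp add: y_def[of "d + j"])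
  \<comment> \<open>If the pivot is zero, then so are \<open>v\<close> and \<open>w\<close>; the
    factors are then arbitrary, and any choice works below.\<close>
  obtain p where p: "\<And>i. i < d \<Longrightarrow> p i \<in> carrier R" "\<And>i. i < d \<Longrightarrow> v i = p i \<otimes> y \<mu>"
    using div_v by metis
  obtain q where q: "\<And>j. j < e \<Longrightarrow> q j \<in> carrier R" "\<And>j. j < e \<Longrightarrow> w j = q j \<otimes> y \<mu>"
    using div_w by metis
  have p_Pi: "p \<in> {..<d} \<rightarrow> carrier R" and q_Pi: "q \<in> {..<e} \<rightarrow> carrier R" using p(1) q(1) by auto
  have "\<forall>i<d. \<forall>j<e. ?E i j \<in> V"
  proof (cases "\<mu> < d")
    case True
    have y_\<mu>: "y \<mu> = v \<mu>" using True by (simp add: y_def)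
    have vp: "\<forall>i<d. v i = p i \<otimes> v \<mu>" and wq: "\<And>j. j < e \<Longrightarrow> w j = q j \<otimes> v \<mu>"
      using p(2) q(2) unfolding y_\<mu> by blast+
    let ?I = "{i. i < d \<and> p i \<in> Units R}" and ?J = "{j. j < e \<and> ?E \<mu> j \<notin> V}"
    have "?E i j \<notin> V \<longleftrightarrow> p i \<in> Units R \<and> ?E \<mu> j \<notin> V" if ij: "i < d" "j < e" for i j
    proof (rule notin[OF p(1)[OF ij(1)]])
      show "mat d e (\<lambda>ij. ?E i j $$ ij \<oplus> \<ominus> (p i) \<otimes> ?E \<mu> j $$ ij) \<in> V"
        by (rule K_V[OF elem_mat_diff_in_defect[OF v w p_Pi True vp ij q(1)[OF ij(2)] wq[OF ij(2)] ideal_ideal_pow]])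
      show "mat d e (\<lambda>ij. p i \<otimes> ?E \<mu> j $$ ij) \<in> V" if "p i \<notin> Units R"
        by (rule P_V[OF nonunit_in_P[OF p(1)[OF ij(1)] that] elem_mat_in_mats])
    qed
    then have rect: "\<forall>i<d. \<forall>j<e. ?E i j \<notin> V \<longleftrightarrow> i \<in> ?I \<and> j \<in> ?J" by simp
    have IJ: "?I \<subseteq> {..<d}" "?J \<subseteq> {..<e}" by auto
    show ?thesis
      using elem_mats_in_V[OF col u V Rel_V adm units IJ rect] by blast
  next
    case False
    define \<nu> where "\<nu> = \<mu> - d"
    have \<nu>: "\<nu> < e" using \<mu>(1) False by (simp add: \<nu>_def)
    have y_\<mu>: "y \<mu> = w \<nu>" using False by (simp add: y_def \<nu>_def)
    have wq: "\<forall>j<e. w j = q j \<otimes> w \<nu>" and vp: "\<And>i. i < d \<Longrightarrow> v i = p i \<otimes> w \<nu>"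
      using p(2) q(2) unfolding y_\<mu> by blast+
    let ?I = "{i. i < d \<and> ?E i \<nu> \<notin> V}" and ?J = "{j. j < e \<and> q j \<in> Units R}"
    have "?E i j \<notin> V \<longleftrightarrow> q j \<in> Units R \<and> ?E i \<nu> \<notin> V" if ij: "i < d" "j < e" for i j
    proof (rule notin[OF q(1)[OF ij(2)]])
      let ?F = "elem_mat R e d"
      \<comment> \<open>The pivot lies in \<open>w\<close>: the previous case is applied to the
        transposed problem, where columns play the part of rows, and the result is transposed
        back.\<close>
      have "mat e d (\<lambda>ij. ?F j i $$ ij \<oplus> \<ominus> (q j) \<otimes> ?F \<nu> i $$ ij) \<in> defect R alt e d w v (ideal_pow R P (Suc k))"
        by (rule elem_mat_diff_in_defect[OF w v q_Pi \<nu> wq ij(2,1) p(1)[OF ij(1)] vp[OF ij(1)] ideal_ideal_pow])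
      from K_V[OF defect_transpose[OF w v this]]
      show "mat d e (\<lambda>ij. ?E i j $$ ij \<oplus> \<ominus> (q j) \<otimes> ?E i \<nu> $$ ij) \<in> V"
        unfolding transpose_mat_map2[OF elem_mat_in_mats elem_mat_in_mats, where f = "\<lambda>a b. a \<oplus> \<ominus> (q j) \<otimes> b"]
          transpose_elem_mat[OF ij(2,1)] transpose_elem_mat[OF \<nu> ij(1)] .
      show "mat d e (\<lambda>ij. q j \<otimes> ?E i \<nu> $$ ij) \<in> V" if "q j \<notin> Units R"
        by (rule P_V[OF nonunit_in_P[OF q(1)[OF ij(2)] that] elem_mat_in_mats])
    qed
    then have rect: "\<forall>i<d. \<forall>j<e. ?E i j \<notin> V \<longleftrightarrow> i \<in> ?I \<and> j \<in> ?J" by auto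
    have IJ: "?I \<subseteq> {..<d}" "?J \<subseteq> {..<e}" by auto
    show ?thesis
      using elem_mats_in_V[OF col u V Rel_V adm units IJ rect] by blast
  qed
  then have "x \<in> V"
    by (rule mats_spanned_by_elem_mats[OF col u V Rel_V _ Suc.prems])
  then show ?case unfolding V_def by blast
qed

end

section \<open>Transfer to embedded modules enlarged by \<open>N\<close>\<close>

context cring
begin

text \<open>The hypothesis \<open>approx\<close> concerns \<open>M\<close> and \<open>M'\<close>
  alone. If \<open>z\<close> is replaced by \<open>z - D\<close> and the summand from
  \<open>N\<close> is kept, the matrix changes by the embedded \<open>D\<close>. A vector
  \<open>x\<close> times this has zero columns outside the image of \<open>c\<close>, and the
  columns of \<open>(x \<circ> r) D\<close> inside it.\<close>

lemma Zask_embed_cong: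
  assumes P: "ideal P R" and fin: "\<And>k. finite (carrier (R Quot ideal_pow R P k))"
    and rc: "inj_on r {..<m}" "r ` {..<m} \<subseteq> {..<m'}" "inj_on c {..<n}" "c ` {..<n} \<subseteq> {..<n'}"
    and M: "subgroup M (add_monoid (mat_module R m n))"
    and M': "subgroup M' (add_monoid (mat_module R m n))" "M' \<subseteq> M"
    and N: "subgroup N (add_monoid (mat_module R m' n'))"
    and approx: "\<And>k y z. y \<in> {..<m} \<rightarrow> carrier R \<Longrightarrow> z \<in> M \<Longrightarrow>
      \<exists>D\<in>mats R m n. mat m n (\<lambda>ij. z $$ ij \<ominus> D $$ ij) \<in> M' \<and>
        (\<forall>j<n. (\<Oplus>i\<in>{..<m}. y i \<otimes> D $$ (i, j)) \<in> ideal_pow R P k)"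
  shows "Zask R P (mat_embed R m n m' n' r c ` M <+>\<^bsub>mat_module R m' n'\<^esub> N)
       = Zask R P (mat_embed R m n m' n' r c ` M' <+>\<^bsub>mat_module R m' n'\<^esub> N)"
proof -
  let ?emb = "mat_embed R m n m' n' r c"
  let ?B = "?emb ` M <+>\<^bsub>mat_module R m' n'\<^esub> N" and ?B' = "?emb ` M' <+>\<^bsub>mat_module R m' n'\<^esub> N"
  have mem: "?emb ` L <+>\<^bsub>mat_module R m' n'\<^esub> N = {mat m' n' (\<lambda>ij. ?emb a $$ ij \<oplus> b $$ ij) | a b. a \<in> L \<and> b \<in> N}" for L
    by (auto simp: set_add_def' mat_module_simps)
  have "ask (R Quot ideal_pow R P k) (reduce_mats R (ideal_pow R P k) ?B)
      = ask (R Quot ideal_pow R P k) (reduce_mats R (ideal_pow R P k) ?B')" for k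
  proof (rule ask_reduce_cong[OF ideal_pow_ideal[OF P] fin])
    show "subgroup ?B (add_monoid (mat_module R m' n'))"
      by (intro set_add_subgroup mat_embed_subgroup rc M N)
    show "subgroup ?B' (add_monoid (mat_module R m' n'))"
      by (intro set_add_subgroup mat_embed_subgroup rc M' N)
    show "?B' \<subseteq> ?B" using M'(2) unfolding mem by blast
    fix x b assume x: "\<And>i. i < m' \<Longrightarrow> x i \<in> carrier R" and b: "b \<in> ?B"
    interpret Q: ideal "ideal_pow R P k" R by (rule ideal_pow_ideal[OF P])
    obtain z \<nu> where z: "z \<in> M" "\<nu> \<in> N" "b = mat m' n' (\<lambda>ij. ?emb z $$ ij \<oplus> \<nu> $$ ij)"
      using b unfolding mem by blast
    have "x \<circ> r \<in> {..<m} \<rightarrow> carrier R" using x rc(2) by auto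
    from approx[OF this z(1)] obtain D where D: "D \<in> mats R m n" "mat m n (\<lambda>ij. z $$ ij \<ominus> D $$ ij) \<in> M'"
      "\<forall>j<n. (\<Oplus>i\<in>{..<m}. (x \<circ> r) i \<otimes> D $$ (i, j)) \<in> ideal_pow R P k"
      by blast
    let ?z' = "mat m n (\<lambda>ij. z $$ ij \<ominus> D $$ ij)"
    let ?b' = "mat m' n' (\<lambda>ij. ?emb ?z' $$ ij \<oplus> \<nu> $$ ij)"
    have zm: "z \<in> mats R m n" "\<nu> \<in> mats R m' n'"
      using z mats_subgroupD(1)[OF M] mats_subgroupD(1)[OF N] by auto
    note emb = mat_embed_in_mats[OF zm(1), of m' n' r c] mat_embed_in_mats[OF D(1), of m' n' r c]
    have b': "?b' \<in> ?B'" using D(2) z(2) unfolding mem by blast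
    have bm: "b \<in> mats R m' n'" unfolding z(3) using emb(1) zm(2) by (auto simp: mats_def)
    have bm': "?b' \<in> mats R m' n'"
      using mat_embed_in_mats[OF subsetD[OF mats_subgroupD(1)[OF M'(1)] D(2)], of m' n' r c] zm(2)
      by (auto simp: mats_def)
    have cancel: "(p \<oplus> q) \<ominus> ((p \<ominus> s) \<oplus> q) = s" if "p \<in> carrier R" "q \<in> carrier R" "s \<in> carrier R" for p q s
    proof -
      define t where "t = p \<ominus> s"
      have t: "t \<in> carrier R" "p = s \<oplus> t"
        using that by (simp_all add: t_def a_minus_def a_lcomm[of s p] r_neg)
      then have "(p \<oplus> q) \<ominus> (t \<oplus> q) = s \<oplus> ((t \<oplus> q) \<oplus> \<ominus> (t \<oplus> q))"
        using that by (simp add: a_minus_def a_assoc)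
      then show ?thesis using that t(1) by (simp add: r_neg t_def)
    qed
    have diff: "b $$ (i, l) \<ominus> ?b' $$ (i, l) = ?emb D $$ (i, l)" if il: "i < m'" "l < n'" for i l
      unfolding z(3) mat_embed_minus[OF rc zm(1) D(1)]
      using il cancel[OF mats_closed[OF emb(1) il] mats_closed[OF zm(2) il] mats_closed[OF emb(2) il]] by simp
    have "(\<Oplus>i\<in>{..<m'}. x i \<otimes> b $$ (i, l)) \<ominus> (\<Oplus>i\<in>{..<m'}. x i \<otimes> ?b' $$ (i, l)) \<in> ideal_pow R P k"
      if l: "l < n'" for l
    proof -
      have "(\<Oplus>i\<in>{..<m'}. x i \<otimes> b $$ (i, l)) \<ominus> (\<Oplus>i\<in>{..<m'}. x i \<otimes> ?b' $$ (i, l))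
          = (\<Oplus>i\<in>{..<m'}. x i \<otimes> (b $$ (i, l) \<ominus> ?b' $$ (i, l)))"
        using x mats_closed[OF bm _ l] mats_closed[OF bm' _ l] by (intro finsum_mult_minus[symmetric]) auto
      also have "\<dots> = (\<Oplus>i\<in>{..<m'}. x i \<otimes> ?emb D $$ (i, l))"
        using x mats_closed[OF emb(2) _ l] diff[OF _ l] by (intro finsum_cong') auto
      also have "\<dots> \<in> ideal_pow R P k"
      proof (cases "l \<in> c ` {..<n}")
        case True
        then obtain j where j: "j < n" "l = c j" by auto
        have "(\<Oplus>i\<in>{..<m'}. x i \<otimes> ?emb D $$ (i, c j)) = (\<Oplus>i\<in>{..<m}. x (r i) \<otimes> D $$ (i, j))"
          by (rule finsum_mat_embed[OF rc D(1) j(1)]) (rule x)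
        then show ?thesis
          unfolding j(2) using D(3) j(1) by simp
      next
        case False
        have "(\<Oplus>i\<in>{..<m'}. x i \<otimes> ?emb D $$ (i, l)) = \<zero>"
          using x False mat_embed_index_not_image[OF D(1) _ l, of _ m' r c] by (intro finsum_zero_terms) auto
        then show ?thesis by simp
      qed
      finally show ?thesis .
    qed
    then show "\<exists>b'\<in>?B'. \<forall>j<n'. (\<Oplus>i\<in>{..<m'}. x i \<otimes> b $$ (i, j)) \<ominus> (\<Oplus>i\<in>{..<m'}. x i \<otimes> b' $$ (i, j)) \<in> ideal_pow R P k"
      using b' by blast
  qed
  then show ?thesis by (simp add: Zask_def)
qed

lemma finsum_lessThan_add:
  assumes "f \<in> {..<d + e} \<rightarrow> carrier R"
  shows "(\<Oplus>i\<in>{..<d + e :: nat}. f i) = (\<Oplus>i\<in>{..<d}. f i) \<oplus> (\<Oplus>k\<in>{..<e}. f (d + k))"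
  using assms
proof (induction e)
  case 0
  then show ?case by (simp add: finsum_closed)
next
  case (Suc e)
  have f: "f \<in> {..<d + e} \<rightarrow> carrier R" "f (d + e) \<in> carrier R" using Suc.prems by auto
  have "(\<Oplus>i\<in>{..<d + Suc e}. f i) = f (d + e) \<oplus> (\<Oplus>i\<in>{..<d + e}. f i)"
    using f by (simp add: lessThan_Suc finsum_insert)
  also have "\<dots> = (\<Oplus>i\<in>{..<d}. f i) \<oplus> (f (d + e) \<oplus> (\<Oplus>k\<in>{..<e}. f (d + k)))"
    unfolding Suc.IH[OF f(1)] using f by (intro a_lcomm finsum_closed) auto
  also have "f (d + e) \<oplus> (\<Oplus>k\<in>{..<e}. f (d + k)) = (\<Oplus>k\<in>{..<Suc e}. f (d + k))"
    using f unfolding lessThan_Suc by (intro finsum_insert[symmetric]) auto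
  finally show ?case .
qed

subsection \<open>Block matrices\<close>

lemma form_mats_submodule: "submodule (form_mats R alt n) R (mat_module R n n)"
  using form_mats_in_mats[of alt n] form_mats_zero[of n alt]
  by (intro mats_submoduleI form_mats_add form_mats_smult) auto

lemma form_mats_subgroup: "subgroup (form_mats R alt n) (add_monoid (mat_module R n n))"
  by (rule submodule.axioms(1)[OF form_mats_submodule])

text \<open>The block matrices of \<open>ARel\<close> and \<open>SRel\<close> in one formula; the
  entrywise form lets the sign rule be checked block by block.\<close>

definition form_block :: "bool \<Rightarrow> nat \<Rightarrow> nat \<Rightarrow> 'a mat \<Rightarrow> 'a mat \<Rightarrow> 'a mat \<Rightarrow> 'a mat" where
  "form_block alt d e a x b = mat (d + e) (d + e) (\<lambda>(i, j).
     if i < d then if j < d then a $$ (i, j) else x $$ (i, j - d)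
     else if j < d then form_sign R alt \<otimes> x $$ (j, i - d) else b $$ (i - d, j - d))"

definition upper_right :: "nat \<Rightarrow> nat \<Rightarrow> 'a mat \<Rightarrow> 'a mat" where
  "upper_right d e z = mat d e (\<lambda>(i, j). z $$ (i, d + j))"

lemma form_sign_cancel: "x \<in> carrier R \<Longrightarrow> form_sign R alt \<otimes> (form_sign R alt \<otimes> x) = x"
  by (simp add: m_assoc[symmetric] form_sign_square)

lemma form_block_in_form_mats:
  assumes "a \<in> form_mats R alt d" "b \<in> form_mats R alt e" "x \<in> mats R d e"
  shows "form_block alt d e a x b \<in> form_mats R alt (d + e)"
proof (rule form_matsI)
  have ab: "a \<in> mats R d d" "b \<in> mats R e e" using assms form_mats_in_mats by blast+
  show "form_block alt d e a x b \<in> mats R (d + e) (d + e)"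
    unfolding form_block_def
  proof (rule mat_in_mats)
    fix i j assume ij: "i < d + e" "j < d + e"
    then show "(case (i, j) of (i, j) \<Rightarrow>
     if i < d then if j < d then a $$ (i, j) else x $$ (i, j - d)
     else if j < d then form_sign R alt \<otimes> x $$ (j, i - d) else b $$ (i - d, j - d)) \<in> carrier R"
      using mats_closed[OF ab(1), of i j] mats_closed[OF ab(2), of "i - d" "j - d"]
        mats_closed[OF assms(3), of i "j - d"] mats_closed[OF assms(3), of j "i - d"] by simp
  qed
  fix i assume i: "i < d + e"
  show "form_block alt d e a x b $$ (i, i) = \<zero>" if alt
    using form_matsD(2)[OF assms(1) that, of i] form_matsD(2)[OF assms(2) that, of "i - d"] i
    by (simp add: form_block_def)
  fix j assume j: "j < d + e"
  consider "i < d" "j < d" | "i < d" "\<not> j < d" | "\<not> i < d" "j < d" | "\<not> i < d" "\<not> j < d" by blast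
  then show "form_block alt d e a x b $$ (j, i) = form_sign R alt \<otimes> form_block alt d e a x b $$ (i, j)"
  proof cases
    case 1
    then show ?thesis using i j form_matsD(1)[OF assms(1) 1] unfolding form_block_def by simp
  next
    case 2
    then show ?thesis using i j unfolding form_block_def by simp
  next
    case 3
    then show ?thesis
      using i j form_sign_cancel mats_closed[OF assms(3), of j "i - d"] unfolding form_block_def by simp
  next
    case 4
    have "i - d < e" "j - d < e" using 4 i j by auto
    from form_matsD(1)[OF assms(2) this] show ?thesis using 4 i j unfolding form_block_def by simp
  qed
qed

lemma upper_right_form_block:
  assumes "x \<in> mats R d e"
  shows "upper_right d e (form_block alt d e a x b) = x"
  by (rule eq_matI) (use assms in \<open>auto simp: upper_right_def form_block_def mats_def\<close>)

lemma upper_right_in_mats: "z \<in> mats R (d + e) (d + e) \<Longrightarrow> upper_right d e z \<in> mats R d e"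
  by (auto simp: upper_right_def mats_def)

lemma upper_right_minus:
  "upper_right d e (mat (d + e) (d + e) (\<lambda>ij. z $$ ij \<ominus> z' $$ ij))
    = mat d e (\<lambda>ij. upper_right d e z $$ ij \<ominus> upper_right d e z' $$ ij)"
  by (rule eq_matI) (auto simp: upper_right_def)

lemma form_mats_eq_form_block:
  assumes z: "z \<in> form_mats R alt (d + e)"
  shows "\<exists>a\<in>form_mats R alt d. \<exists>b\<in>form_mats R alt e. z = form_block alt d e a (upper_right d e z) b"
proof -
  let ?a = "mat d d (\<lambda>ij. z $$ ij)" and ?b = "mat e e (\<lambda>(i, j). z $$ (d + i, d + j))"
  have m: "z \<in> mats R (d + e) (d + e)" using z form_mats_in_mats by blast
  have "?a \<in> form_mats R alt d"
  proof (rule form_matsI)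
    show "?a \<in> mats R d d" using m by (auto simp: mats_def)
    show "?a $$ (j, i) = form_sign R alt \<otimes> ?a $$ (i, j)" if "i < d" "j < d" for i j
      using that form_matsD(1)[OF z, of i j] by simp
    show "?a $$ (i, i) = \<zero>" if alt "i < d" for i
      using that form_matsD(2)[OF z that(1), of i] by simp
  qed
  moreover have "?b \<in> form_mats R alt e"
  proof (rule form_matsI)
    show "?b \<in> mats R e e" using m by (auto simp: mats_def)
    show "?b $$ (j, i) = form_sign R alt \<otimes> ?b $$ (i, j)" if "i < e" "j < e" for i j
      using that form_matsD(1)[OF z, of "d + i" "d + j"] by simp
    show "?b $$ (i, i) = \<zero>" if alt "i < e" for i
      using that form_matsD(2)[OF z that(1), of "d + i"] by simp
  qed
  moreover have "z = form_block alt d e ?a (upper_right d e z) ?b"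
  proof (rule eq_matI)
    fix i j assume "i < dim_row (form_block alt d e ?a (upper_right d e z) ?b)"
      "j < dim_col (form_block alt d e ?a (upper_right d e z) ?b)"
    then have ij: "i < d + e" "j < d + e" by (auto simp: form_block_def)
    show "z $$ (i, j) = form_block alt d e ?a (upper_right d e z) ?b $$ (i, j)"
      using ij form_matsD(1)[OF z ij(2,1)] by (simp add: form_block_def upper_right_def)
  qed (use mats_dim[OF m] in \<open>auto simp: form_block_def\<close>)
  ultimately show ?thesis by blast
qed

text \<open>The diagonal blocks range freely, so only the upper right block is restricted. In this
  form \<open>ARel\<close> and \<open>SRel\<close> are preimages of \<open>Rel\<close> under the
  additive map \<open>upper_right\<close>, which yields their subgroup property and their link with
  \<open>defect\<close>.\<close>

lemma form_block_image:
  assumes "L \<subseteq> mats R d e"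
  shows "{form_block alt d e a x b | a b x. a \<in> form_mats R alt d \<and> b \<in> form_mats R alt e \<and> x \<in> L}
    = {z \<in> form_mats R alt (d + e). upper_right d e z \<in> L}" (is "?A = ?B")
proof
  show "?A \<subseteq> ?B"
    using assms form_block_in_form_mats upper_right_form_block by fastforce
  show "?B \<subseteq> ?A"
  proof
    fix z assume z: "z \<in> ?B"
    then obtain a b where "a \<in> form_mats R alt d" "b \<in> form_mats R alt e"
      "z = form_block alt d e a (upper_right d e z) b"
      using form_mats_eq_form_block by blast
    then show "z \<in> ?A" using z by blast
  qed
qed

lemma ARel_eq: "ARel R d e C \<A> u = {z \<in> form_mats R True (d + e). upper_right d e z \<in> Rel R d e C \<A> u}"
proof -
  have "four_block_mat a x (map_mat (a_inv R) (transpose_mat x)) b = form_block True d e a x b"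
    if "a \<in> mats R d d" "b \<in> mats R e e" "x \<in> mats R d e" for a x b
    by (rule eq_matI) (use that in \<open>auto simp: form_block_def mats_def form_sign_def l_minus\<close>)
  then have "ARel R d e C \<A> u = {form_block True d e a x b | a b x.
      a \<in> form_mats R True d \<and> b \<in> form_mats R True e \<and> x \<in> Rel R d e C \<A> u}"
    using Rel_in_mats[of d e C \<A> u] form_mats_in_mats[of True d] form_mats_in_mats[of True e]
    unfolding ARel_def form_mats_def by (auto simp: subset_iff) (metis, metis)
  then show ?thesis using form_block_image[OF Rel_in_mats] by simp
qed

lemma SRel_eq: "SRel R d e C \<A> u = {z \<in> form_mats R False (d + e). upper_right d e z \<in> Rel R d e C \<A> u}"
proof -
  have "four_block_mat a x (transpose_mat x) b = form_block False d e a x b"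
    if "a \<in> mats R d d" "b \<in> mats R e e" "x \<in> mats R d e" for a x b
    by (rule eq_matI) (use that in \<open>auto simp: form_block_def mats_def form_sign_def\<close>)
  then have "SRel R d e C \<A> u = {form_block False d e a x b | a b x.
      a \<in> form_mats R False d \<and> b \<in> form_mats R False e \<and> x \<in> Rel R d e C \<A> u}"
    using Rel_in_mats[of d e C \<A> u] form_mats_in_mats[of False d] form_mats_in_mats[of False e]
    unfolding SRel_def form_mats_def by (auto simp: subset_iff) (metis, metis)
  then show ?thesis using form_block_image[OF Rel_in_mats] by simp
qed

lemma Rel_subgroup:
  assumes "partial_colouring d e C \<A>" "u \<in> mats R d e"
  shows "subgroup (Rel R d e C \<A> u) (add_monoid (mat_module R d e))"
  using Rel_in_mats[of d e C \<A> u] zero_in_Rel[OF assms] Rel_add[OF assms] Rel_smult[OF assms]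
  by (intro submodule.axioms(1)[OF mats_submoduleI]) auto

lemma upper_right_subgroup:
  assumes "subgroup L (add_monoid (mat_module R d e))"
  shows "subgroup {z \<in> form_mats R alt (d + e). upper_right d e z \<in> L} (add_monoid (mat_module R (d + e) (d + e)))"
proof (rule mats_subgroupI)
  let ?B = "{z \<in> form_mats R alt (d + e). upper_right d e z \<in> L}"
  show "?B \<subseteq> mats R (d + e) (d + e)" using form_mats_in_mats by blast
  obtain x where x: "x \<in> L" "x \<in> mats R d e" using mats_subgroupD(1,4)[OF assms] by blast
  have "form_block alt d e (mat d d (\<lambda>_. \<zero>)) x (mat e e (\<lambda>_. \<zero>)) \<in> ?B"
    using form_block_in_form_mats[OF form_mats_zero form_mats_zero x(2)] upper_right_form_block[OF x(2)] x(1) by simp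
  then show "?B \<noteq> {}" by blast
  fix z z' assume "z \<in> ?B" "z' \<in> ?B"
  then show "mat (d + e) (d + e) (\<lambda>ij. z $$ ij \<ominus> z' $$ ij) \<in> ?B"
    using mats_subgroupD(3)[OF form_mats_subgroup[of alt "d + e"], of z z'] mats_subgroupD(3)[OF assms]
    by (simp add: upper_right_minus)
qed

lemma finsum_form_block:
  assumes y: "y \<in> {..<d + e} \<rightarrow> carrier R"
    and abx: "a \<in> mats R d d" "b \<in> mats R e e" "x \<in> mats R d e"
  shows "j < e \<Longrightarrow> (\<Oplus>i\<in>{..<d + e}. y i \<otimes> form_block alt d e a x b $$ (i, d + j))
      = (\<Oplus>i\<in>{..<d}. y i \<otimes> x $$ (i, j)) \<oplus> (\<Oplus>k\<in>{..<e}. y (d + k) \<otimes> b $$ (k, j))"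
    and "i < d \<Longrightarrow> (\<Oplus>k\<in>{..<d + e}. y k \<otimes> form_block alt d e a x b $$ (k, i))
      = (\<Oplus>k\<in>{..<d}. y k \<otimes> a $$ (k, i)) \<oplus> (\<Oplus>j\<in>{..<e}. y (d + j) \<otimes> (form_sign R alt \<otimes> transpose_mat x $$ (j, i)))"
proof -
  have yc: "y i \<in> carrier R" if "i < d + e" for i using Pi_mem[OF y] that by simp
  show "(\<Oplus>i\<in>{..<d + e}. y i \<otimes> form_block alt d e a x b $$ (i, d + j))
      = (\<Oplus>i\<in>{..<d}. y i \<otimes> x $$ (i, j)) \<oplus> (\<Oplus>k\<in>{..<e}. y (d + k) \<otimes> b $$ (k, j))" if j: "j < e"
  proof -
    have "(\<Oplus>i\<in>{..<d + e}. y i \<otimes> form_block alt d e a x b $$ (i, d + j))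
        = (\<Oplus>i\<in>{..<d}. y i \<otimes> form_block alt d e a x b $$ (i, d + j))
          \<oplus> (\<Oplus>k\<in>{..<e}. y (d + k) \<otimes> form_block alt d e a x b $$ (d + k, d + j))"
      using yc j mats_closed[OF abx(2)] mats_closed[OF abx(3)]
      by (intro finsum_lessThan_add) (auto simp: form_block_def)
    also have "(\<Oplus>i\<in>{..<d}. y i \<otimes> form_block alt d e a x b $$ (i, d + j)) = (\<Oplus>i\<in>{..<d}. y i \<otimes> x $$ (i, j))"
      using yc j mats_closed[OF abx(3)] by (intro finsum_cong') (auto simp: form_block_def)
    also have "(\<Oplus>k\<in>{..<e}. y (d + k) \<otimes> form_block alt d e a x b $$ (d + k, d + j)) = (\<Oplus>k\<in>{..<e}. y (d + k) \<otimes> b $$ (k, j))"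
      using yc j mats_closed[OF abx(2)] by (intro finsum_cong') (auto simp: form_block_def)
    finally show ?thesis .
  qed
  show "(\<Oplus>k\<in>{..<d + e}. y k \<otimes> form_block alt d e a x b $$ (k, i))
      = (\<Oplus>k\<in>{..<d}. y k \<otimes> a $$ (k, i)) \<oplus> (\<Oplus>j\<in>{..<e}. y (d + j) \<otimes> (form_sign R alt \<otimes> transpose_mat x $$ (j, i)))"
    if i: "i < d"
  proof -
    have "(\<Oplus>k\<in>{..<d + e}. y k \<otimes> form_block alt d e a x b $$ (k, i))
        = (\<Oplus>k\<in>{..<d}. y k \<otimes> form_block alt d e a x b $$ (k, i))
          \<oplus> (\<Oplus>k\<in>{..<e}. y (d + k) \<otimes> form_block alt d e a x b $$ (d + k, i))"
      using yc i mats_closed[OF abx(1)] mats_closed[OF abx(3)]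
      by (intro finsum_lessThan_add) (auto simp: form_block_def)
    also have "(\<Oplus>k\<in>{..<d}. y k \<otimes> form_block alt d e a x b $$ (k, i)) = (\<Oplus>k\<in>{..<d}. y k \<otimes> a $$ (k, i))"
      using yc i mats_closed[OF abx(1)] by (intro finsum_cong') (auto simp: form_block_def)
    also have "(\<Oplus>k\<in>{..<e}. y (d + k) \<otimes> form_block alt d e a x b $$ (d + k, i))
        = (\<Oplus>j\<in>{..<e}. y (d + j) \<otimes> (form_sign R alt \<otimes> transpose_mat x $$ (j, i)))"
      using yc i mats_dim[OF abx(3)] mats_closed[OF abx(3)] by (intro finsum_cong') (auto simp: form_block_def)
    finally show ?thesis .
  qed
qed

text \<open>The lower left block is the sign times the transpose of \<open>x\<close>. With
  \<open>a\<close> multiplied by the same sign, each of the first \<open>d\<close> columns of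
  \<open>y D\<close> is the sign times a sum that \<open>defect\<close> places in \<open>Q\<close>;
  the other columns are such sums directly.\<close>

lemma defect_form_block:
  assumes y: "y \<in> {..<d + e} \<rightarrow> carrier R" and Q: "ideal Q R"
    and x: "x \<in> defect R alt d e y (\<lambda>j. y (d + j)) Q"
  shows "\<exists>D\<in>form_mats R alt (d + e). upper_right d e D = x \<and> (\<forall>j<d + e. (\<Oplus>i\<in>{..<d + e}. y i \<otimes> D $$ (i, j)) \<in> Q)"
proof -
  let ?w = "\<lambda>j. y (d + j)" and ?s = "form_sign R alt"
  have v: "y \<in> {..<d} \<rightarrow> carrier R" and w: "?w \<in> {..<e} \<rightarrow> carrier R" using y by (auto simp: Pi_iff)
  obtain a b where ab: "x \<in> mats R d e" "a \<in> form_mats R alt d" "b \<in> form_mats R alt e"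
    "\<And>j. j < e \<Longrightarrow> (\<Oplus>i\<in>{..<d}. y i \<otimes> x $$ (i, j)) \<oplus> (\<Oplus>k\<in>{..<e}. ?w k \<otimes> b $$ (k, j)) \<in> Q"
    "\<And>i. i < d \<Longrightarrow> (\<Oplus>j\<in>{..<e}. ?w j \<otimes> transpose_mat x $$ (j, i)) \<oplus> (\<Oplus>k\<in>{..<d}. y k \<otimes> a $$ (k, i)) \<in> Q"
    by (rule defectE[OF v w x]) (rule that)
  let ?a = "mat d d (\<lambda>ij. ?s \<otimes> a $$ ij)"
  let ?D = "form_block alt d e ?a x b"
  have a': "?a \<in> form_mats R alt d" by (rule form_mats_smult[OF ab(2) form_sign_closed])
  have m: "?a \<in> mats R d d" "b \<in> mats R e e" "a \<in> mats R d d"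
    using a' ab(2,3) form_mats_in_mats by blast+
  note tr = transpose_mats[OF ab(1)]
  have "(\<Oplus>i\<in>{..<d + e}. y i \<otimes> ?D $$ (i, j)) \<in> Q" if j: "j < d + e" for j
  proof (cases "j < d")
    case True
    have "(\<Oplus>k\<in>{..<e}. ?w k \<otimes> (?s \<otimes> transpose_mat x $$ (k, j))) = ?s \<otimes> (\<Oplus>k\<in>{..<e}. ?w k \<otimes> transpose_mat x $$ (k, j))"
      using Pi_mem[OF w] mats_closed[OF tr _ True] by (intro finsum_mult_left) auto
    then have "(\<Oplus>i\<in>{..<d + e}. y i \<otimes> ?D $$ (i, j))
        = ?s \<otimes> (\<Oplus>k\<in>{..<d}. y k \<otimes> a $$ (k, j)) \<oplus> ?s \<otimes> (\<Oplus>k\<in>{..<e}. ?w k \<otimes> transpose_mat x $$ (k, j))"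
      unfolding finsum_form_block(2)[OF y m(1,2) ab(1) True] col_smult[OF v m(3) form_sign_closed True] by simp
    also have "\<dots> = ?s \<otimes> ((\<Oplus>k\<in>{..<e}. ?w k \<otimes> transpose_mat x $$ (k, j)) \<oplus> (\<Oplus>k\<in>{..<d}. y k \<otimes> a $$ (k, j)))"
      using col_closed[OF v m(3) True] col_closed[OF w tr True] by (simp add: r_distr a_comm)
    also have "\<dots> \<in> Q" by (rule ideal.I_l_closed[OF Q ab(5)[OF True] form_sign_closed])
    finally show ?thesis .
  next
    case False
    then have l: "j - d < e" "d + (j - d) = j" using j by auto
    show ?thesis
      using finsum_form_block(1)[OF y m(1,2) ab(1) l(1), of alt] ab(4)[OF l(1)] unfolding l(2) by simp
  qed
  then show ?thesis
    using form_block_in_form_mats[OF a' ab(3,1)] upper_right_form_block[OF ab(1)] by blast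
qed

end

section \<open>Approximation in the three cases\<close>

context compact_dvr
begin

text \<open>For \<open>w = \<zero>\<close> the block \<open>b\<close> drops out of the column sums,
  and membership in \<open>defect\<close> says that \<open>y D\<close> vanishes modulo the power of
  \<open>P\<close>. The value \<open>True\<close> is an arbitrary choice.\<close>

lemma exists_Rel_approx:
  assumes col: "partial_colouring d e C \<A>" and adm: "admissible d e C \<A>" and u: "u \<in> mats R d e"
    and units: "\<forall>i<d. \<forall>j<e. u $$ (i, j) \<in> Units R" and "d > 0"
    and y: "y \<in> {..<d} \<rightarrow> carrier R" and z: "z \<in> mats R d e"
  shows "\<exists>D\<in>mats R d e. mat d e (\<lambda>ij. z $$ ij \<ominus> D $$ ij) \<in> Rel R d e C \<A> u \<and>
    (\<forall>j<e. (\<Oplus>i\<in>{..<d}. y i \<otimes> D $$ (i, j)) \<in> ideal_pow R P k)"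
proof -
  have w: "(\<lambda>_. \<zero>) \<in> {..<e} \<rightarrow> carrier R" by simp
  have de: "d + e > 0" using assms(5) by simp
  obtain D where D: "D \<in> defect R True d e y (\<lambda>_. \<zero>) (ideal_pow R P k)"
    "mat d e (\<lambda>ij. z $$ ij \<ominus> D $$ ij) \<in> Rel R d e C \<A> u"
    using Rel_plus_defect[OF col adm u units de y w z] by blast
  obtain a b where ab: "D \<in> mats R d e" "b \<in> form_mats R True e"
    "\<And>j. j < e \<Longrightarrow> (\<Oplus>i\<in>{..<d}. y i \<otimes> D $$ (i, j)) \<oplus> (\<Oplus>k\<in>{..<e}. \<zero> \<otimes> b $$ (k, j)) \<in> ideal_pow R P k"
    by (rule defectE[OF y w D(1)]) (rule that)
  have b: "b \<in> mats R e e" using ab(2) form_mats_in_mats by blast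
  have "(\<Oplus>i\<in>{..<d}. y i \<otimes> D $$ (i, j)) \<in> ideal_pow R P k" if j: "j < e" for j
  proof -
    have "(\<Oplus>k\<in>{..<e}. \<zero> \<otimes> b $$ (k, j)) = \<zero>"
      using mats_closed[OF b _ j] by (intro finsum_zero_terms) auto
    then show ?thesis using ab(3)[OF j] col_closed[OF y ab(1) j] by simp
  qed
  then show ?thesis using D(2) ab(1) by blast
qed

text \<open>The upper right block of \<open>z\<close> is corrected into \<open>Rel\<close> by an
  element of \<open>defect\<close>, which extends to a matrix \<open>D\<close> of the same kind as
  \<open>z\<close> that \<open>y\<close> sends into the power of \<open>P\<close>; then
  \<open>D\<close> is subtracted from \<open>z\<close>.\<close>

lemma exists_form_approx:
  assumes col: "partial_colouring d e C \<A>" and adm: "admissible d e C \<A>" and u: "u \<in> mats R d e"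
    and units: "\<forall>i<d. \<forall>j<e. u $$ (i, j) \<in> Units R" and "d > 0"
    and y: "y \<in> {..<d + e} \<rightarrow> carrier R" and z: "z \<in> form_mats R alt (d + e)"
  shows "\<exists>D\<in>mats R (d + e) (d + e). mat (d + e) (d + e) (\<lambda>ij. z $$ ij \<ominus> D $$ ij)
      \<in> {z \<in> form_mats R alt (d + e). upper_right d e z \<in> Rel R d e C \<A> u} \<and>
    (\<forall>j<d + e. (\<Oplus>i\<in>{..<d + e}. y i \<otimes> D $$ (i, j)) \<in> ideal_pow R P k)"
proof -
  have v: "y \<in> {..<d} \<rightarrow> carrier R" and w: "(\<lambda>j. y (d + j)) \<in> {..<e} \<rightarrow> carrier R"
    using y by (auto simp: Pi_iff)
  have de: "d + e > 0" using assms(5) by simp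
  have zm: "upper_right d e z \<in> mats R d e"
    using z form_mats_in_mats by (intro upper_right_in_mats) blast
  obtain x where x: "x \<in> defect R alt d e y (\<lambda>j. y (d + j)) (ideal_pow R P k)"
    "mat d e (\<lambda>ij. upper_right d e z $$ ij \<ominus> x $$ ij) \<in> Rel R d e C \<A> u"
    using Rel_plus_defect[OF col adm u units de v w zm] by blast
  obtain D where D: "D \<in> form_mats R alt (d + e)" "upper_right d e D = x"
    "\<forall>j<d + e. (\<Oplus>i\<in>{..<d + e}. y i \<otimes> D $$ (i, j)) \<in> ideal_pow R P k"
    using defect_form_block[OF y ideal_ideal_pow x(1)] by blast
  have "mat (d + e) (d + e) (\<lambda>ij. z $$ ij \<ominus> D $$ ij) \<in> form_mats R alt (d + e)"
    by (rule mats_subgroupD(3)[OF form_mats_subgroup z D(1)])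
  then have "mat (d + e) (d + e) (\<lambda>ij. z $$ ij \<ominus> D $$ ij)
      \<in> {z \<in> form_mats R alt (d + e). upper_right d e z \<in> Rel R d e C \<A> u}"
    using x(2) by (simp add: upper_right_minus D(2))
  moreover have "D \<in> mats R (d + e) (d + e)" using D(1) form_mats_in_mats by blast
  ultimately show ?thesis using D(3) by blast
qed

lemma mats_subgroup: "subgroup (mats R d e) (add_monoid (mat_module R d e))"
  by (intro mats_subgroupI mats_minus) (auto intro: elem_mat_in_mats)

end

theorem theoremA:
  fixes R :: "('a, 'b) ring_scheme" (structure)
    and P :: "'a set"
    and d e m n m' n' :: nat
    and C :: "'c set" and \<A> :: "'c \<Rightarrow> (nat \<times> nat) set"
    and u :: "'a mat"
    and M M' N :: "'a mat set"
    and r c :: "nat \<Rightarrow> nat"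
  assumes "compact_dvr R P"
    and "d \<ge> 1" and "e \<ge> 1"
    and "partial_colouring d e C \<A>" and "admissible d e C \<A>"
    and "u \<in> mats R d e" and "\<And>i j. i < d \<Longrightarrow> j < e \<Longrightarrow> u $$ (i, j) \<in> Units R"
    and "m = d \<and> n = e \<and> M = mats R d e \<and> M' = Rel R d e C \<A> u
       \<or> m = d + e \<and> n = d + e \<and> M = Alt R (d + e) \<and> M' = ARel R d e C \<A> u
       \<or> m = d + e \<and> n = d + e \<and> M = Sym R (d + e) \<and> M' = SRel R d e C \<A> u"
    and "strict_mono_on {..<m} r" and "r ` {..<m} \<subseteq> {..<m'}"
    and "strict_mono_on {..<n} c" and "c ` {..<n} \<subseteq> {..<n'}"
    and "submodule N R (mat_module R m' n')"
  shows "Zask R P (mat_embed R m n m' n' r c ` M <+>\<^bsub>mat_module R m' n'\<^esub> N)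
       = Zask R P (mat_embed R m n m' n' r c ` M' <+>\<^bsub>mat_module R m' n'\<^esub> N)"
proof -
  interpret compact_dvr R P by fact
  note col = assms(4) and adm = assms(5) and u = assms(6)
  have d: "d > 0" using assms(2) by simp
  have units: "\<forall>i<d. \<forall>j<e. u $$ (i, j) \<in> Units R" using assms(7) by blast
  have rc: "inj_on r {..<m}" "r ` {..<m} \<subseteq> {..<m'}" "inj_on c {..<n}" "c ` {..<n} \<subseteq> {..<n'}"
    using assms(9-12) strict_mono_on_imp_inj_on by auto
  have N: "subgroup N (add_monoid (mat_module R m' n'))"
    by (rule submodule.axioms(1)[OF assms(13)])
  \<comment> \<open>The alternating and the symmetric case merge into one with parameter
    \<open>alt\<close>.\<close>
  from assms(8) consider "m = d" "n = e" "M = mats R d e" "M' = Rel R d e C \<A> u"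
    | alt where "m = d + e" "n = d + e" "M = form_mats R alt (d + e)"
      "M' = {z \<in> form_mats R alt (d + e). upper_right d e z \<in> Rel R d e C \<A> u}"
  proof (elim disjE conjE)
    assume "m = d + e" "n = d + e" "M = Alt R (d + e)" "M' = ARel R d e C \<A> u"
    then show thesis using that(2)[of True] by (simp add: ARel_eq form_mats_def)
  next
    assume "m = d + e" "n = d + e" "M = Sym R (d + e)" "M' = SRel R d e C \<A> u"
    then show thesis using that(2)[of False] by (simp add: SRel_eq form_mats_def)
  qed (rule that(1))
  then show ?thesis
  proof cases
    case 1
    show ?thesis
    proof (rule Zask_embed_cong[OF ideal_P finite_quotient rc _ _ _ N])
      show "subgroup M (add_monoid (mat_module R m n))" using mats_subgroup by (simp add: 1)
      show "subgroup M' (add_monoid (mat_module R m n))" using Rel_subgroup[OF col u] by (simp add: 1)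
      show "M' \<subseteq> M" using Rel_in_mats by (simp add: 1)
      fix k y z assume "y \<in> {..<m} \<rightarrow> carrier R" "z \<in> M"
      then show "\<exists>D\<in>mats R m n. mat m n (\<lambda>ij. z $$ ij \<ominus> D $$ ij) \<in> M' \<and>
          (\<forall>j<n. (\<Oplus>i\<in>{..<m}. y i \<otimes> D $$ (i, j)) \<in> ideal_pow R P k)"
        unfolding 1 by (rule exists_Rel_approx[OF col adm u units d])
    qed
  next
    case 2
    show ?thesis
    proof (rule Zask_embed_cong[OF ideal_P finite_quotient rc _ _ _ N])
      show "subgroup M (add_monoid (mat_module R m n))" unfolding 2 by (rule form_mats_subgroup)
      show "subgroup M' (add_monoid (mat_module R m n))"
        unfolding 2 by (rule upper_right_subgroup[OF Rel_subgroup[OF col u]])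
      show "M' \<subseteq> M" unfolding 2 by blast
      fix k y z assume "y \<in> {..<m} \<rightarrow> carrier R" "z \<in> M"
      then show "\<exists>D\<in>mats R m n. mat m n (\<lambda>ij. z $$ ij \<ominus> D $$ ij) \<in> M' \<and>
          (\<forall>j<n. (\<Oplus>i\<in>{..<m}. y i \<otimes> D $$ (i, j)) \<in> ideal_pow R P k)"
        unfolding 2 by (rule exists_form_approx[OF col adm u units d])
    qed
  qed
qed

end
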